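(* Given a set $P$ of $n$ weighted points in the plane (weights are arbitrary reals, possibly negative), a set $Q$ of $m$ unweighted points in the plane, and a positive integer $k$, the maxDominance problem can be solved in $O(km^2+n\log m)$ time and $O(n+m)$ space.
   Context: For a point $q$, $dom(q)=(-\infty,x(q)]\times(-\infty,y(q)]$; for $Q'\subseteq Q$, $dom(Q')=\bigcup_{q\in Q'}dom(q)$. For a region $R$, $w(R)$ is the sum of the weights of the points of $P$ lying in $R$ (zero if none). The maxDominance problem asks to compute $\mathrm{maxDominance}(P,Q,k)=\max\{w(dom(Q')):Q'\subseteq Q,\ |Q'|\le k\}$. *)

theory Defs
  imports Complex_Main
begin

type_synonym point = "real \<times> real"

definition dom_point :: "point \<Rightarrow> point set" where
  "dom_point q = {..fst q} \<times> {..snd q}"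

definition dom_set :: "point set \<Rightarrow> point set" where
  "dom_set Q' = (\<Union>q\<in>Q'. dom_point q)"

definition region_weight :: "point set \<Rightarrow> (point \<Rightarrow> real) \<Rightarrow> point set \<Rightarrow> real" where
  "region_weight P w R = sum w (P \<inter> R)"

definition maxDominance :: "point set \<Rightarrow> (point \<Rightarrow> real) \<Rightarrow> point set \<Rightarrow> nat \<Rightarrow> real" where
  "maxDominance P w Q k =
     Max {region_weight P w (dom_set Q') | Q'. Q' \<subseteq> Q \<and> card Q' \<le> k}"

text \<open>
  Programs are while-programs over a real RAM with two random-access memories: one whose cells hold
  machine words (natural numbers, also used as addresses) and one whose cells hold exact reals.
  Program variables are memory cells with constant addresses. There is no conversion from reals to
  words, hence no floor operation. Every operation, literal, memory access and control transfer has
  unit cost. Word subtraction is truncated at 0; division by 0 yields 0 for words and for reals.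
\<close>

datatype wexp =
    WLit nat
  | WLoad wexp
  | WAdd wexp wexp
  | WSub wexp wexp
  | WMul wexp wexp
  | WDiv wexp wexp

datatype rexp =
    RLit int
  | RLoad wexp
  | RAdd rexp rexp
  | RSub rexp rexp
  | RMul rexp rexp
  | RDiv rexp rexp

datatype bexp =
    WLess wexp wexp
  | RLess rexp rexp
  | BNot bexp
  | BAnd bexp bexp

datatype com =
    Skip
  | WStore wexp wexp
  | RStore wexp rexp
  | Seq com com
  | Cond bexp com com
  | While bexp com

record state =
  wmem :: "nat \<Rightarrow> nat"
  rmem :: "nat \<Rightarrow> real"

fun wval :: "state \<Rightarrow> wexp \<Rightarrow> nat" where
  "wval s (WLit a) = a"
| "wval s (WLoad e) = wmem s (wval s e)"
| "wval s (WAdd e f) = wval s e + wval s f"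
| "wval s (WSub e f) = wval s e - wval s f"
| "wval s (WMul e f) = wval s e * wval s f"
| "wval s (WDiv e f) = wval s e div wval s f"

fun rval :: "state \<Rightarrow> rexp \<Rightarrow> real" where
  "rval s (RLit a) = of_int a"
| "rval s (RLoad e) = rmem s (wval s e)"
| "rval s (RAdd e f) = rval s e + rval s f"
| "rval s (RSub e f) = rval s e - rval s f"
| "rval s (RMul e f) = rval s e * rval s f"
| "rval s (RDiv e f) = rval s e / rval s f"

fun bval :: "state \<Rightarrow> bexp \<Rightarrow> bool" where
  "bval s (WLess e f) = (wval s e < wval s f)"
| "bval s (RLess e f) = (rval s e < rval s f)"
| "bval s (BNot b) = (\<not> bval s b)"
| "bval s (BAnd b c) = (bval s b \<and> bval s c)"

text \<open>
  A machine has \<open>S\<close> cells in each memory, with addresses \<open>0, \<dots>, S - 1\<close>, and its words range over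
  \<open>0, \<dots>, W - 1\<close>. Evaluation is legal if every address used lies in the memory and every word
  computed on the way fits into a machine word. The size of the addresses, not the number of
  distinct cells accessed, is what is charged as space.
\<close>

fun wlegal :: "nat \<Rightarrow> nat \<Rightarrow> state \<Rightarrow> wexp \<Rightarrow> bool" where
  "wlegal S W s (WLit a) = (a < W)"
| "wlegal S W s (WLoad e) = (wlegal S W s e \<and> wval s e < S \<and> wval s (WLoad e) < W)"
| "wlegal S W s (WAdd e f) = (wlegal S W s e \<and> wlegal S W s f \<and> wval s (WAdd e f) < W)"
| "wlegal S W s (WSub e f) = (wlegal S W s e \<and> wlegal S W s f)"
| "wlegal S W s (WMul e f) = (wlegal S W s e \<and> wlegal S W s f \<and> wval s (WMul e f) < W)"
| "wlegal S W s (WDiv e f) = (wlegal S W s e \<and> wlegal S W s f)"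

fun rlegal :: "nat \<Rightarrow> nat \<Rightarrow> state \<Rightarrow> rexp \<Rightarrow> bool" where
  "rlegal S W s (RLit a) = True"
| "rlegal S W s (RLoad e) = (wlegal S W s e \<and> wval s e < S)"
| "rlegal S W s (RAdd e f) = (rlegal S W s e \<and> rlegal S W s f)"
| "rlegal S W s (RSub e f) = (rlegal S W s e \<and> rlegal S W s f)"
| "rlegal S W s (RMul e f) = (rlegal S W s e \<and> rlegal S W s f)"
| "rlegal S W s (RDiv e f) = (rlegal S W s e \<and> rlegal S W s f)"

fun blegal :: "nat \<Rightarrow> nat \<Rightarrow> state \<Rightarrow> bexp \<Rightarrow> bool" where
  "blegal S W s (WLess e f) = (wlegal S W s e \<and> wlegal S W s f)"
| "blegal S W s (RLess e f) = (rlegal S W s e \<and> rlegal S W s f)"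
| "blegal S W s (BNot b) = blegal S W s b"
| "blegal S W s (BAnd b c) = (blegal S W s b \<and> blegal S W s c)"

fun wcost :: "wexp \<Rightarrow> nat" where
  "wcost (WLit a) = 1"
| "wcost (WLoad e) = 1 + wcost e"
| "wcost (WAdd e f) = 1 + wcost e + wcost f"
| "wcost (WSub e f) = 1 + wcost e + wcost f"
| "wcost (WMul e f) = 1 + wcost e + wcost f"
| "wcost (WDiv e f) = 1 + wcost e + wcost f"

fun rcost :: "rexp \<Rightarrow> nat" where
  "rcost (RLit a) = 1"
| "rcost (RLoad e) = 1 + wcost e"
| "rcost (RAdd e f) = 1 + rcost e + rcost f"
| "rcost (RSub e f) = 1 + rcost e + rcost f"
| "rcost (RMul e f) = 1 + rcost e + rcost f"
| "rcost (RDiv e f) = 1 + rcost e + rcost f"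

fun bcost :: "bexp \<Rightarrow> nat" where
  "bcost (WLess e f) = 1 + wcost e + wcost f"
| "bcost (RLess e f) = 1 + rcost e + rcost f"
| "bcost (BNot b) = 1 + bcost b"
| "bcost (BAnd b c) = 1 + bcost b + bcost c"

text \<open>
  \<open>exec S W c s t s'\<close>: on the machine with parameters \<open>S\<close> and \<open>W\<close>, program \<open>c\<close> started in state
  \<open>s\<close> halts in state \<open>s'\<close> after exactly \<open>t\<close> time units without an illegal operation. Execution is
  deterministic; a run that diverges, leaves the memory or overflows a word has no derivation.
\<close>

inductive exec :: "nat \<Rightarrow> nat \<Rightarrow> com \<Rightarrow> state \<Rightarrow> nat \<Rightarrow> state \<Rightarrow> bool"
  for S W :: nat
where
  Skip: "exec S W Skip s 1 s"
| WStore: "\<lbrakk>wlegal S W s a; wval s a < S; wlegal S W s e\<rbrakk> \<Longrightarrow>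
    exec S W (WStore a e) s (1 + wcost a + wcost e)
      (s\<lparr>wmem := (wmem s)(wval s a := wval s e)\<rparr>)"
| RStore: "\<lbrakk>wlegal S W s a; wval s a < S; rlegal S W s e\<rbrakk> \<Longrightarrow>
    exec S W (RStore a e) s (1 + wcost a + rcost e)
      (s\<lparr>rmem := (rmem s)(wval s a := rval s e)\<rparr>)"
| Seq: "\<lbrakk>exec S W c s t s'; exec S W d s' u s''\<rbrakk> \<Longrightarrow> exec S W (Seq c d) s (t + u) s''"
| CondTrue: "\<lbrakk>blegal S W s b; bval s b; exec S W c s t s'\<rbrakk> \<Longrightarrow>
    exec S W (Cond b c d) s (1 + bcost b + t) s'"
| CondFalse: "\<lbrakk>blegal S W s b; \<not> bval s b; exec S W d s t s'\<rbrakk> \<Longrightarrow>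
    exec S W (Cond b c d) s (1 + bcost b + t) s'"
| WhileFalse: "\<lbrakk>blegal S W s b; \<not> bval s b\<rbrakk> \<Longrightarrow> exec S W (While b c) s (1 + bcost b) s"
| WhileTrue: "\<lbrakk>blegal S W s b; bval s b; exec S W c s t s'; exec S W (While b c) s' u s''\<rbrakk> \<Longrightarrow>
    exec S W (While b c) s (1 + bcost b + t + u) s''"

definition mem_of :: "'a::zero list \<Rightarrow> nat \<Rightarrow> 'a" where
  "mem_of xs i = (if i < length xs then xs ! i else 0)"

text \<open>
  The input is an arbitrary enumeration \<open>ps\<close> of the weighted points and \<open>qs\<close> of the unweighted
  points; nothing is presorted. All cells not holding input are 0.
\<close>

definition input_state :: "point list \<Rightarrow> (point \<Rightarrow> real) \<Rightarrow> point list \<Rightarrow> nat \<Rightarrow> state" where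
  "input_state ps w qs k =
     \<lparr>wmem = mem_of [length ps, length qs, k],
      rmem = mem_of (map fst ps @ map snd ps @ map w ps @ map fst qs @ map snd qs)\<rparr>"

definition result :: "state \<Rightarrow> real" where
  "result s = rmem s 0"

end

theory Submission
  imports Defs
begin

text \<open>
  A union of dominance regions depends only on its maximal points, and these form a staircase.
  Rank \<open>Q\<close> by both coordinates. Cutting the region below a staircase at the columns of its points
  shows that its weight is the sum, over consecutive points \<open>c\<close>, \<open>c'\<close>, of the weight of the strip
  between the columns of \<open>c\<close> and \<open>c'\<close> below the row of \<open>c'\<close>. So if \<open>best j c\<close> is the largest
  weight that at most \<open>j\<close> further points can add to the right of \<open>c\<close>, then \<open>best (Suc j)\<close> is
  obtained from \<open>best j\<close> in one sweep over the rows from bottom to top that maintains the weight of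
  every column below the current row; the answer is \<open>best k\<close> at a sentinel left of and above all
  points.

  A sweep takes \<open>O(m^2)\<close> time because each row reads off only its own weights: the weighted points are
  located in the \<open>m\<close> by \<open>m\<close> grid by binary search, and are first merged into one item per grid cell
  when \<open>m^2 < n\<close>, so there are at most \<open>min n (m^2)\<close> items, kept in one linked list per row.
\<close>

subsection \<open>Weakest preconditions with running time\<close>

text \<open>The obstacle is that neither k * n time nor m^2 space is allowed. Letting each of the k
  passes read all points would cost k * n; a table over the whole grid would make passes cheap but
  needs m^2 cells. Comparing m^2 with n resolves both: a table is built only when it has fewer than
  n cells. The strip weights for all pairs c, c' would again fill m^2 cells, so they are never
  stored: when the sweep stands at the row of c', the strips ending at c' are suffix sums of the
  current column weights, and one walk to the left produces them in turn. Only two layers of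
  \<open>best\<close> are kept. Ranks are found by comparing all pairs of Q, whose m^2 steps
  disappear in k * m^2 because k >= 1. Weights may be negative, so a longer staircase need not be
  better; therefore \<open>best\<close> ranges over at most j points, and the strips are an exact
  disjoint decomposition. The numerical factors in the time bounds are rounded-up counts of unit
  steps.\<close>

notation Seq (infixr \<open>;;\<close> 55)

text \<open>\<open>t\<close> is the clock reading before the run, and \<open>Q\<close> sees the
  reading afterwards. Passing absolute time along turns the bound for a sequence into a single
  inequality on the clock. Requiring a derivation of \<open>exec\<close> includes termination and
  legality.\<close>

definition ok :: "nat \<Rightarrow> nat \<Rightarrow> state \<Rightarrow> com \<Rightarrow> nat \<Rightarrow> (nat \<Rightarrow> state \<Rightarrow> bool) \<Rightarrow> bool" where
  "ok S W s c t Q \<longleftrightarrow> (\<exists>t' s'. exec S W c s t' s' \<and> Q (t + t') s')"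

inductive_cases exec_SkipE: "exec S W Skip s t s'"
inductive_cases exec_WStoreE: "exec S W (WStore a e) s t s'"
inductive_cases exec_RStoreE: "exec S W (RStore a e) s t s'"
inductive_cases exec_SeqE: "exec S W (Seq c d) s t s'"
inductive_cases exec_CondE: "exec S W (Cond b c d) s t s'"

lemma ok_Skip: "ok S W s Skip t Q \<longleftrightarrow> Q (t + 1) s"
  unfolding ok_def by (auto elim!: exec_SkipE intro!: exI[of _ 1] exec.Skip)

lemma ok_WStore:
  "ok S W s (WStore a e) t Q \<longleftrightarrow>
     wlegal S W s a \<and> wval s a < S \<and> wlegal S W s e \<and>
     Q (t + (1 + wcost a + wcost e)) (s\<lparr>wmem := (wmem s)(wval s a := wval s e)\<rparr>)"
  unfolding ok_def
  by (rule iffI; (elim exE conjE exec_WStoreE)?) (auto intro!: exI exec.WStore)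

lemma ok_RStore:
  "ok S W s (RStore a e) t Q \<longleftrightarrow>
     wlegal S W s a \<and> wval s a < S \<and> rlegal S W s e \<and>
     Q (t + (1 + wcost a + rcost e)) (s\<lparr>rmem := (rmem s)(wval s a := rval s e)\<rparr>)"
  unfolding ok_def
  by (rule iffI; (elim exE conjE exec_RStoreE)?) (auto intro!: exI exec.RStore)

lemma ok_Seq: "ok S W s (Seq c d) t Q \<longleftrightarrow> ok S W s c t (\<lambda>t s. ok S W s d t Q)"
proof
  assume "ok S W s (Seq c d) t Q"
  then show "ok S W s c t (\<lambda>t s. ok S W s d t Q)"
    unfolding ok_def by (elim exE conjE exec_SeqE) (auto simp: add.assoc)
next
  assume "ok S W s c t (\<lambda>t s. ok S W s d t Q)"
  then show "ok S W s (Seq c d) t Q"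
    unfolding ok_def by (metis exec.Seq add.assoc)
qed

lemma ok_Cond:
  "ok S W s (Cond b c d) t Q \<longleftrightarrow>
     blegal S W s b \<and> (if bval s b then ok S W s c (t + (1 + bcost b)) Q
                       else ok S W s d (t + (1 + bcost b)) Q)"
proof
  assume "ok S W s (Cond b c d) t Q"
  then show "blegal S W s b \<and> (if bval s b then ok S W s c (t + (1 + bcost b)) Q
                       else ok S W s d (t + (1 + bcost b)) Q)"
    unfolding ok_def by (elim exE conjE exec_CondE) (auto simp: add.assoc)
next
  assume "blegal S W s b \<and> (if bval s b then ok S W s c (t + (1 + bcost b)) Q
                       else ok S W s d (t + (1 + bcost b)) Q)"
  then show "ok S W s (Cond b c d) t Q"
    unfolding ok_def using exec.CondTrue exec.CondFalse
    by (smt (verit, ccfv_threshold) add.assoc)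
qed

text \<open>\<open>n\<close> bounds the rounds still to come and is part of the invariant, so one
  induction gives termination and running time. The guard may fail while \<open>n\<close> is still
  positive, which lets a binary search stop early.\<close>

lemma ok_While:
  fixes n :: nat
  assumes "I n t s"
    and "\<And>n t s. I n t s \<Longrightarrow> blegal S W s b \<and>
      (if bval s b then n > 0 \<and> ok S W s c (t + (1 + bcost b)) (I (n - 1))
       else Q (t + (1 + bcost b)) s)"
  shows "ok S W s (While b c) t Q"
  using assms(1)
proof (induct n arbitrary: t s)
  case 0
  then have "blegal S W s b" "\<not> bval s b" "Q (t + (1 + bcost b)) s"
    using assms(2)[OF 0] by (auto split: if_splits)
  then show ?case unfolding ok_def using exec.WhileFalse by blast
next
  case (Suc n)
  note step = assms(2)[OF Suc(2)]
  show ?case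
  proof (cases "bval s b")
    case True
    then obtain t1 s1 where 1: "exec S W c s t1 s1" "I n (t + (1 + bcost b) + t1) s1"
      using step by (auto simp: ok_def)
    from Suc(1)[OF 1(2)] obtain t2 s2 where
      2: "exec S W (While b c) s1 t2 s2" "Q (t + (1 + bcost b) + t1 + t2) s2"
      by (auto simp: ok_def)
    have "exec S W (While b c) s (1 + bcost b + t1 + t2) s2"
      using exec.WhileTrue 1 2 step True by blast
    then show ?thesis unfolding ok_def using 2(2) by (metis add.assoc)
  next
    case False
    then show ?thesis using step exec.WhileFalse unfolding ok_def by fastforce
  qed
qed

text \<open>Subtraction and division have no range check of their own, but their values do not
  exceed the first operand.\<close>

lemma wlegal_less: "wlegal S W s e \<Longrightarrow> wval s e < W"
  by (induction e) (auto intro: le_less_trans[OF diff_le_self] le_less_trans[OF div_le_dividend])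

text \<open>
  Index \<open>i\<close> of the word array \<open>a < 32\<close> is cell \<open>32 * i + a\<close>, and index \<open>i\<close> of the real array \<open>a < 8\<close>
  is cell \<open>8 * (n + m + i) + a\<close>, beyond the input. Interleaving makes every cell address determine
  the array and the index, whatever the lengths. Scalars live at index 0 of their own array.

  Words: 0--2 input sizes \<open>n\<close>, \<open>m\<close>, \<open>k\<close>; 4, 5, 15 loop counters; 6, 7 rank counters; 8--10 binary search;
  11 current item; 12, 13 columns; 14 number of items; 16 row of a column (with \<open>m + 1\<close> at the sentinel 0);
  17 column of a row; 18, 19 column and row of an item; 20 next item, 21 first item of a row (0 ends a list).
  Reals: 0 accumulator; 2, 3 sorted coordinates of \<open>Q\<close>; 4 item weights; 5 column weights;
  6, 7 the values \<open>best\<close> of the previous and the current pass.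
\<close>

definition Var :: "nat \<Rightarrow> wexp" where "Var v = WLoad (WLit v)"
definition nV :: wexp where "nV = Var 0"
definition mV :: wexp where "mV = Var 1"
definition kV :: wexp where "kV = Var 2"
definition word_addr :: "nat \<Rightarrow> wexp \<Rightarrow> wexp" where
  "word_addr a e = WAdd (WMul (WLit 32) e) (WLit a)"
definition real_addr :: "nat \<Rightarrow> wexp \<Rightarrow> wexp" where
  "real_addr a e = WAdd (WMul (WLit 8) (WAdd (WAdd (Var 0) (Var 1)) e)) (WLit a)"
definition WArr :: "nat \<Rightarrow> wexp \<Rightarrow> wexp" where "WArr a e = WLoad (word_addr a e)"
definition RArr :: "nat \<Rightarrow> wexp \<Rightarrow> rexp" where "RArr a e = RLoad (real_addr a e)"
definition PX :: "wexp \<Rightarrow> rexp" where "PX e = RLoad e"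
definition PY :: "wexp \<Rightarrow> rexp" where "PY e = RLoad (WAdd (Var 0) e)"
definition PW :: "wexp \<Rightarrow> rexp" where "PW e = RLoad (WAdd (WMul (WLit 2) (Var 0)) e)"
definition QX :: "wexp \<Rightarrow> rexp" where "QX e = RLoad (WAdd (WMul (WLit 3) (Var 0)) e)"
definition QY :: "wexp \<Rightarrow> rexp" where
  "QY e = RLoad (WAdd (WAdd (WMul (WLit 3) (Var 0)) (Var 1)) e)"
definition VSet :: "nat \<Rightarrow> wexp \<Rightarrow> com" where "VSet v e = WStore (WLit v) e"
definition WSet :: "nat \<Rightarrow> wexp \<Rightarrow> wexp \<Rightarrow> com" where "WSet a i e = WStore (word_addr a i) e"
definition RSet :: "nat \<Rightarrow> wexp \<Rightarrow> rexp \<Rightarrow> com" where "RSet a i e = RStore (real_addr a i) e"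

definition For :: "nat \<Rightarrow> wexp \<Rightarrow> com \<Rightarrow> com" where
  "For v e c = Seq (VSet v (WLit 0))
     (While (WLess (Var v) e) (Seq c (VSet v (WAdd (Var v) (WLit 1)))))"

lemma cost_simps [simp]:
  "wcost (Var v) = 2" "wcost nV = 2" "wcost mV = 2" "wcost kV = 2" "wcost (WArr a e) = wcost e + 5" "rcost (RArr a e) = wcost e + 11"
  "rcost (PX e) = wcost e + 1" "rcost (PY e) = wcost e + 4" "rcost (PW e) = wcost e + 6"
  "rcost (QX e) = wcost e + 6" "rcost (QY e) = wcost e + 9"
  "wcost (word_addr a e) = wcost e + 4" "wcost (real_addr a e) = wcost e + 10"
  by (simp_all add: Var_def nV_def mV_def kV_def WArr_def RArr_def PX_def PY_def PW_def QX_def QY_def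
        word_addr_def real_addr_def)

text \<open>The value 0 for \<open>a >= 32\<close> makes frame conditions over all \<open>a\<close>
  true: otherwise array 37 would be array 5 shifted by one index.\<close>

definition wv :: "state \<Rightarrow> nat \<Rightarrow> nat \<Rightarrow> nat" where
  "wv s a i = (if a < 32 then wmem s (32 * i + a) else 0)"
definition wset :: "nat \<Rightarrow> nat \<Rightarrow> nat \<Rightarrow> state \<Rightarrow> state" where
  "wset a i x s = s\<lparr>wmem := (wmem s)(32 * i + a := x)\<rparr>"

lemma stride_inj: "a < d \<Longrightarrow> b < d \<Longrightarrow> d * i + a = d * j + b \<longleftrightarrow> a = b \<and> i = (j::nat)"
  by (smt (verit, best) add.commute add_right_cancel bot_nat_0.not_eq_extremum div_mult_self4 div_less mod_less mod_mult_self2 plus_nat.add_0 not_less_zero)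

lemma wv_wset [simp]: "a < 32 \<Longrightarrow> wv (wset a i x s) = (wv s)(a := (wv s a)(i := x))"
  by (auto simp: wv_def wset_def fun_eq_iff stride_inj)

lemma wval_Var [simp]: "v < 32 \<Longrightarrow> wval s (Var v) = wv s v 0"
  by (simp add: Var_def wv_def)

lemma wval_WArr [simp]: "a < 32 \<Longrightarrow> wval s (WArr a e) = wv s a (wval s e)"
  by (simp add: WArr_def word_addr_def wv_def)

text \<open>Indices reach n + m + 1, so the word arrays end below 32 * (n + m + 2); the real arrays
  start at 8 * (n + m) and end below 16 * (n + m + 2). \<open>SW\<close> lets a word hold any
  address, and \<open>mW\<close> lets it hold the number of grid cells, which is computed even when
  no grid is built.\<close>

locale ram =
  fixes ps :: "point list" and w :: "point \<Rightarrow> real" and qs :: "point list" and k S W :: nat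
    and n m :: nat
  defines "n \<equiv> length ps" and "m \<equiv> length qs"
  assumes S: "32 * (n + m + 2) \<le> S" and SW: "S \<le> W" and mW: "(m + 1) * (m + 1) < W" and kW: "k < W"
begin

abbreviation "xp i \<equiv> fst (ps ! i)"
abbreviation "yp i \<equiv> snd (ps ! i)"
abbreviation "wp i \<equiv> w (ps ! i)"
abbreviation "xq i \<equiv> fst (qs ! i)"
abbreviation "yq i \<equiv> snd (qs ! i)"

text \<open>Loading a word is legal only if its value fits, so the bound covers every cell. The
  input reals survive because 3 * n + 2 * m <= 8 * (n + m), where the real arrays begin.\<close>

definition wfs :: "state \<Rightarrow> bool" where
  "wfs s \<longleftrightarrow> (\<forall>x. wmem s x < W) \<and> wmem s 0 = n \<and> wmem s 1 = m \<and> wmem s 2 = k \<and>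
     (\<forall>x < 3 * n + 2 * m. rmem s x = rmem (input_state ps w qs k) x)"

definition rv :: "state \<Rightarrow> nat \<Rightarrow> nat \<Rightarrow> real" where
  "rv s a i = (if a < 8 then rmem s (8 * (n + m + i) + a) else 0)"
definition rset :: "nat \<Rightarrow> nat \<Rightarrow> real \<Rightarrow> state \<Rightarrow> state" where
  "rset a i x s = s\<lparr>rmem := (rmem s)(8 * (n + m + i) + a := x)\<rparr>"

lemma rv_rset [simp]: "a < 8 \<Longrightarrow> rv (rset a i x s) = (rv s)(a := (rv s a)(i := x))"
  by (auto simp: rv_def rset_def fun_eq_iff stride_inj)

lemma rv_wset [simp]: "rv (wset a i x s) = rv s"
  by (simp add: rv_def wset_def fun_eq_iff)

lemma wv_rset [simp]: "wv (rset a i x s) = wv s"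
  by (simp add: wv_def rset_def fun_eq_iff)

lemma wfs_rset [simp]: "wfs s \<Longrightarrow> wfs (rset a i x s)"
  by (auto simp: wfs_def rset_def)

lemma wfs_wset [simp]:
  "wfs s \<Longrightarrow> 3 \<le> a \<Longrightarrow> a < 32 \<Longrightarrow> wfs (wset a i x s) \<longleftrightarrow> x < W"
  by (auto simp: wfs_def wset_def)

lemma wfs_wv [simp]:
  assumes "wfs s"
  shows "wv s 0 0 = n" "wv s (Suc 0) 0 = m" "wv s 2 0 = k"
  using assms by (simp_all add: wfs_def wv_def flip: numeral_2_eq_2)

lemma wfs_wv_less: "wfs s \<Longrightarrow> wv s a i < W"
  using S SW by (auto simp: wfs_def wv_def)

lemma small: "x \<le> 32 \<Longrightarrow> x < W" "x < 32 \<Longrightarrow> x < S" using S SW by auto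

lemma W_pos [simp]: "0 < W" "Suc 0 < W" by (simp_all add: small)

lemma wlegal_Var [simp]: "wfs s \<Longrightarrow> v < 32 \<Longrightarrow> wlegal S W s (Var v)"
  using wfs_wv_less[of s v 0] by (simp add: Var_def small wv_def)

lemma wval_dims [simp]:
  assumes "wfs s"
  shows "wval s nV = n" "wval s mV = m" "wval s kV = k"
    "wlegal S W s nV" "wlegal S W s mV" "wlegal S W s kV"
  using assms by (simp_all add: nV_def mV_def kV_def)

lemma word_addr_legal:
  assumes "wlegal S W s e" "wval s e \<le> n + m + 1" "a < 32"
  shows "wlegal S W s (word_addr a e)" "wval s (word_addr a e) < S"
  using assms S SW by (auto simp: word_addr_def)

lemma wval_word_addr: "wval s (word_addr a e) = 32 * wval s e + a"
  by (simp add: word_addr_def)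

lemma real_addr_legal:
  assumes "wfs s" "wlegal S W s e" "wval s e \<le> n + m + 1" "a < 8"
  shows "wlegal S W s (real_addr a e)" "wval s (real_addr a e) < S"
  using assms S SW by (auto simp: real_addr_def)

lemma wval_real_addr: "wfs s \<Longrightarrow> wval s (real_addr a e) = 8 * (n + m + wval s e) + a"
  by (simp add: real_addr_def)

lemma wlegal_WArr [simp]:
  "wfs s \<Longrightarrow> a < 32 \<Longrightarrow> wlegal S W s e \<Longrightarrow> wval s e \<le> n + m + 1 \<Longrightarrow> wlegal S W s (WArr a e)"
  using word_addr_legal[of s e a] wfs_wv_less[of s a "wval s e"]
  by (simp add: WArr_def wval_word_addr wv_def)

lemma rlegal_RArr [simp]:
  "wfs s \<Longrightarrow> a < 8 \<Longrightarrow> wlegal S W s e \<Longrightarrow> wval s e \<le> n + m + 1 \<Longrightarrow> rlegal S W s (RArr a e)"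
  using real_addr_legal[of s e a] by (simp add: RArr_def)

lemma rval_RArr [simp]: "wfs s \<Longrightarrow> a < 8 \<Longrightarrow> rval s (RArr a e) = rv s a (wval s e)"
  by (simp add: RArr_def wval_real_addr rv_def)

lemma rlegal_input [simp]:
  assumes "wfs s" "wlegal S W s e"
  shows "wval s e < n \<Longrightarrow> rlegal S W s (PX e)"
    "wval s e < n \<Longrightarrow> rlegal S W s (PY e)"
    "wval s e < n \<Longrightarrow> rlegal S W s (PW e)"
    "wval s e < m \<Longrightarrow> rlegal S W s (QX e)"
    "wval s e < m \<Longrightarrow> rlegal S W s (QY e)"
  using assms S SW by (auto simp: PX_def PY_def PW_def QX_def QY_def)

lemma rval_input [simp]:
  assumes "wfs s"
  shows "wval s e < n \<Longrightarrow> rval s (PX e) = xp (wval s e)"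
    "wval s e < n \<Longrightarrow> rval s (PY e) = yp (wval s e)"
    "wval s e < n \<Longrightarrow> rval s (PW e) = wp (wval s e)"
    "wval s e < m \<Longrightarrow> rval s (QX e) = xq (wval s e)"
    "wval s e < m \<Longrightarrow> rval s (QY e) = yq (wval s e)"
proof -
  have r: "rmem s x = mem_of (map fst ps @ map snd ps @ map w ps @ map fst qs @ map snd qs) x"
    if "x < 3 * n + 2 * m" for x
    using assms that by (simp add: wfs_def input_state_def)
  show "wval s e < n \<Longrightarrow> rval s (PX e) = xp (wval s e)"
    "wval s e < n \<Longrightarrow> rval s (PY e) = yp (wval s e)"
    "wval s e < n \<Longrightarrow> rval s (PW e) = wp (wval s e)"
    "wval s e < m \<Longrightarrow> rval s (QX e) = xq (wval s e)"
    "wval s e < m \<Longrightarrow> rval s (QY e) = yq (wval s e)"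
    using assms
    by (auto simp: PX_def PY_def PW_def QX_def QY_def r)
      (auto simp: mem_of_def nth_append n_def m_def)
qed

abbreviation "run \<equiv> ok S W"

lemma run_Seq: "run s (c ;; d) t Q \<longleftrightarrow> run s c t (\<lambda>t s. run s d t Q)"
  by (rule ok_Seq)

text \<open>Well-formedness of the new state is a premise of the postcondition and so available to
  all later steps: a legally evaluated expression already has a value below
  \<open>W\<close>.\<close>

lemma run_VSet:
  assumes "wfs s" "3 \<le> v" "v < 32"
  shows "run s (VSet v e) t Q \<longleftrightarrow> wlegal S W s e \<and>
    (wfs (wset v 0 (wval s e) s) \<longrightarrow> Q (t + (wcost e + 2)) (wset v 0 (wval s e) s))"
  using assms wlegal_less[of S W s e] small(1)[of v] small(2)[of v] wfs_wset[of s v 0 "wval s e"]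
  by (auto simp: VSet_def ok_WStore wset_def simp del: wfs_wset)

lemma run_WSet:
  assumes "wfs s" "3 \<le> a" "a < 32"
  shows "run s (WSet a i e) t Q \<longleftrightarrow> wlegal S W s (word_addr a i) \<and> wval s (word_addr a i) < S \<and>
    wlegal S W s e \<and> (wfs (wset a (wval s i) (wval s e) s) \<longrightarrow>
      Q (t + (wcost i + wcost e + 5)) (wset a (wval s i) (wval s e) s))"
  using assms wlegal_less[of S W s e] wfs_wset[of s a "wval s i" "wval s e"]
  by (auto simp: WSet_def ok_WStore wval_word_addr wset_def ac_simps simp del: wfs_wset)

lemma run_RSet:
  assumes "wfs s" "a < 8"
  shows "run s (RSet a i e) t Q \<longleftrightarrow> wlegal S W s (real_addr a i) \<and> wval s (real_addr a i) < S \<and>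
    rlegal S W s e \<and> Q (t + (wcost i + rcost e + 11)) (rset a (wval s i) (rval s e) s)"
  using assms by (simp add: RSet_def ok_RStore wval_real_addr rset_def ac_simps)

text \<open>The invariant speaks of the state in which the counter has already been set.
  Initialisation costs 3, a test \<open>wcost e + 4\<close>, an increment 6. The bound
  \<open>e\<close> is re-evaluated in every round, so the invariant has to fix its value; since that
  value is a legal word, \<open>Suc i\<close> fits whenever \<open>i < N\<close>.\<close>

lemma run_For:
  assumes wf: "wfs s" "4 \<le> v" "v < 32"
    and start: "wfs (wset v 0 0 s) \<Longrightarrow> I 0 (t + 3) (wset v 0 0 s)"
    and bound: "\<And>i t s. wfs s \<Longrightarrow> i \<le> N \<Longrightarrow> I i t s \<Longrightarrow> wlegal S W s e \<and> wval s e = N"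
    and body: "\<And>i t s. wfs s \<Longrightarrow> i < N \<Longrightarrow> Suc i < W \<Longrightarrow> I i t s \<Longrightarrow> wv s v 0 = i \<Longrightarrow>
       run s c (t + (wcost e + 4)) (\<lambda>t s. wfs s \<and> wv s v 0 = i \<and> I (Suc i) (t + 6) (wset v 0 (Suc i) s))"
    and final: "\<And>t s. wfs s \<Longrightarrow> I N t s \<Longrightarrow> Q (t + (wcost e + 4)) s"
  shows "run s (For v e c) t Q"
proof -
  have W: "1 < W" "0 < W" by (simp_all add: small)
  show ?thesis
  proof -
    have wfs0: "wfs (wset v 0 0 s)" using wf W by simp
    define J where "J = (\<lambda>r t s. \<exists>i. i + r = N \<and> wfs s \<and> wv s v 0 = i \<and> I i t s)"
    have "run (wset v 0 0 s)
     (While (WLess (Var v) e) (Seq c (VSet v (WAdd (Var v) (WLit 1))))) (t + 3) Q"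
    proof (rule ok_While[where I=J and n=N])
      show "J N (t + 3) (wset v 0 0 s)"
        using start[OF wfs0] wfs0 wf by (simp add: J_def)
    next
      fix r t s assume "J r t s"
      then obtain i where i: "i + r = N" "wfs s" "wv s v 0 = i" "I i t s" by (auto simp: J_def)
      have b: "wlegal S W s e" "wval s e = N" using bound[OF i(2) _ i(4)] i(1) by auto
      have "N < W" using b wlegal_less by metis
      have *: "run s c (t + (wcost e + 4)) (\<lambda>t s. wfs s \<and> wv s v 0 = i \<and> I (Suc i) (t + 6) (wset v 0 (Suc i) s))"
        if "i < N" using body[OF i(2) that _ i(4) i(3)] that \<open>N < W\<close> by simp
      have "run s (Seq c (VSet v (WAdd (Var v) (WLit 1)))) (t + (wcost e + 4)) (J (r - 1))" if iN: "i < N"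
      proof -
        obtain t' s' where 1: "exec S W c s t' s'" "wfs s'" "wv s' v 0 = i"
             "I (Suc i) (t + (wcost e + 4) + t' + 6) (wset v 0 (Suc i) s')"
          using *[OF iN] by (auto simp: ok_def)
        have "run s' (VSet v (WAdd (Var v) (WLit 1))) (t + (wcost e + 4) + t') (J (r - 1))"
          using 1 wf iN i(1) \<open>N < W\<close> W
          by (subst run_VSet) (auto simp: J_def eval_nat_numeral)
        then show ?thesis unfolding ok_Seq using 1 ok_def by blast
      qed
      then show "blegal S W s (WLess (Var v) e) \<and>
       (if bval s (WLess (Var v) e)
        then 0 < r \<and> run s (Seq c (VSet v (WAdd (Var v) (WLit 1)))) (t + (1 + bcost (WLess (Var v) e))) (J (r - 1))
        else Q (t + (1 + bcost (WLess (Var v) e))) s)"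
        using i b wf final[OF i(2), of t] by (auto simp: eval_nat_numeral)
    qed
    then show ?thesis
      unfolding For_def ok_Seq using wf W by (simp add: run_VSet eval_nat_numeral)
  qed
qed

lemmas run_simps = ok_Skip ok_Seq ok_Cond run_VSet run_WSet run_RSet word_addr_legal real_addr_legal

end

subsection \<open>Ranks and the recurrence along staircases\<close>

text \<open>Breaking ties by index makes this a bijection onto {1..m} even when coordinates
  repeat.\<close>

definition rank :: "(nat \<Rightarrow> 'a::linorder) \<Rightarrow> nat \<Rightarrow> nat \<Rightarrow> nat" where
  "rank f m i = Suc (card {j. j < m \<and> (f j < f i \<or> f j = f i \<and> j < i)})"

definition position :: "(nat \<Rightarrow> 'a::linorder) \<Rightarrow> nat \<Rightarrow> 'a \<Rightarrow> nat" where
  "position f m v = Suc (card {i. i < m \<and> f i < v})"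

lemma rank_less_iff:
  assumes "i < m" "j < m"
  shows "rank f m i < rank f m j \<longleftrightarrow> f i < f j \<or> f i = f j \<and> i < j"
proof -
  have less: "rank f m i < rank f m j" if "f i < f j \<or> f i = f j \<and> i < j" "i < m" for i j
    unfolding rank_def using that by (intro Suc_mono psubset_card_mono) auto
  show ?thesis
    using less[of i j] less[of j i] assms by (metis less_asym linorder_neqE)
qed

lemma rank_range: "i < m \<Longrightarrow> rank f m i \<in> {1..m}"
proof -
  assume "i < m"
  have "card {j. j < m \<and> (f j < f i \<or> f j = f i \<and> j < i)} < card {..<m}"
    using \<open>i < m\<close> by (intro psubset_card_mono) auto
  then show ?thesis by (simp add: rank_def)
qed

lemma rank_bij: "bij_betw (rank f m) {..<m} {1..m}"
proof -
  have inj: "inj_on (rank f m) {..<m}"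
  proof (rule inj_onI)
    fix i j assume "i \<in> {..<m}" "j \<in> {..<m}" "rank f m i = rank f m j"
    then show "i = j"
      using rank_less_iff[of i m j f] rank_less_iff[of j m i f] by (metis lessThan_iff less_irrefl linorder_neqE)
  qed
  have "rank f m ` {..<m} = {1..m}"
  proof (rule card_subset_eq)
    show "rank f m ` {..<m} \<subseteq> {1..m}" by (intro image_subsetI rank_range) simp
    show "card (rank f m ` {..<m}) = card {1..m}" using card_image[OF inj] by simp
  qed simp
  then show ?thesis using inj by (simp add: bij_betw_def)
qed

text \<open>This lets integer comparisons replace dominance by closed quadrants. If
  \<open>v <= f i\<close>, every value strictly below \<open>v\<close> belongs to a predecessor of
  \<open>i\<close>. Otherwise \<open>i\<close> and all its predecessors have values below
  \<open>v\<close>, so the position exceeds the rank.\<close>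

lemma position_le_rank: "i < m \<Longrightarrow> position f m v \<le> rank f m i \<longleftrightarrow> v \<le> f i"
proof -
  assume i: "i < m"
  show ?thesis
  proof (cases "v \<le> f i")
    case True
    then have "card {i. i < m \<and> f i < v} \<le> card {j. j < m \<and> (f j < f i \<or> f j = f i \<and> j < i)}"
      by (intro card_mono) auto
    then show ?thesis using True by (simp add: rank_def position_def)
  next
    case False
    then have "{j. j < m \<and> (f j < f i \<or> f j = f i \<and> j < i)} \<subseteq> {i. i < m \<and> f i < v} - {i}"
      by auto
    moreover have "i \<in> {i. i < m \<and> f i < v}" using i False by auto
    ultimately have "card {j. j < m \<and> (f j < f i \<or> f j = f i \<and> j < i)} < card {i. i < m \<and> f i < v}"
      by (intro psubset_card_mono) (simp, blast)
    then show ?thesis using False by (simp add: rank_def position_def)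
  qed
qed

lemma position_range: "position f m v \<in> {1..Suc m}"
proof -
  have "card {i. i < m \<and> f i < v} \<le> card {..<m}" by (intro card_mono) auto
  then show ?thesis by (simp add: position_def)
qed

section \<open>Staircases in the rank grid and their recurrence\<close>

locale staircase =
  fixes n m :: nat and cx rp :: "nat \<Rightarrow> nat" and wt :: "nat \<Rightarrow> real" and RK CK :: "nat \<Rightarrow> nat"
  assumes CK: "1 \<le> r \<Longrightarrow> r \<le> m \<Longrightarrow> 1 \<le> CK r \<and> CK r \<le> m \<and> RK (CK r) = r"
    and RK: "1 \<le> c \<Longrightarrow> c \<le> m \<Longrightarrow> 1 \<le> RK c \<and> RK c \<le> m \<and> CK (RK c) = c"
    and RK_0: "m < RK 0"
    and cx_pos: "0 < cx p"
begin

definition colw :: "nat \<Rightarrow> nat \<Rightarrow> real" where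
  "colw r x = (\<Sum>p | p < n \<and> cx p = x \<and> rp p \<le> r. wt p)"

text \<open>Summing by columns is the form in which the sweep meets this weight: at row
  \<open>RK c'\<close> the summands are the maintained column weights. \<open>slab_points\<close>
  gives the geometric reading.\<close>

definition slab :: "nat \<Rightarrow> nat \<Rightarrow> real" where
  "slab c c' = (\<Sum>x\<in>{c<..c'}. colw (RK c') x)"

text \<open>\<open>B\<close> stays fixed while the rows are processed, so a value improved in this
  sweep is not extended again in it, and each sweep spends at most one point. Starting from
  \<open>B c\<close> is the option to spend none.\<close>

primrec sweep :: "(nat \<Rightarrow> real) \<Rightarrow> nat \<Rightarrow> nat \<Rightarrow> real" where
  "sweep B 0 c = B c"
| "sweep B (Suc r) c = (if c < CK (Suc r) \<and> Suc r < RK c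
     then max (sweep B r c) (slab c (CK (Suc r)) + B (CK (Suc r))) else sweep B r c)"

primrec best :: "nat \<Rightarrow> nat \<Rightarrow> real" where
  "best 0 c = 0"
| "best (Suc j) c = sweep (best j) m c"

fun chain :: "nat \<Rightarrow> nat list \<Rightarrow> bool" where
  "chain c [] = True"
| "chain c (c' # cs) = (c < c' \<and> c' \<le> m \<and> RK c' < RK c \<and> chain c' cs)"

fun val :: "nat \<Rightarrow> nat list \<Rightarrow> real" where
  "val c [] = 0"
| "val c (c' # cs) = slab c c' + val c' cs"

text \<open>Row \<open>Suc r\<close> contains the single column \<open>CK (Suc r)\<close>, so each
  candidate is offered in exactly one step, and the maximum never decreases afterwards.\<close>

lemma sweep_upper:
  "r \<le> m \<Longrightarrow> B c \<le> sweep B r c \<and>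
     (\<forall>c'. c < c' \<longrightarrow> c' \<le> m \<longrightarrow> RK c' < RK c \<longrightarrow> RK c' \<le> r \<longrightarrow> slab c c' + B c' \<le> sweep B r c)"
proof (induction r)
  case 0
  show ?case
  proof (intro conjI allI impI)
    fix c' assume "c < c'" "c' \<le> m" "RK c' \<le> 0"
    then show "slab c c' + B c' \<le> sweep B 0 c" using RK[of c'] by simp
  qed simp
next
  case (Suc r)
  then have IH: "B c \<le> sweep B r c"
    "\<And>c'. c < c' \<Longrightarrow> c' \<le> m \<Longrightarrow> RK c' < RK c \<Longrightarrow> RK c' \<le> r \<Longrightarrow> slab c c' + B c' \<le> sweep B r c"
    by auto
  have "slab c c' + B c' \<le> sweep B (Suc r) c"
    if c': "c < c'" "c' \<le> m" "RK c' < RK c" "RK c' \<le> Suc r" for c'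
  proof (cases "RK c' = Suc r")
    case True
    then have "CK (Suc r) = c'" using RK[of c'] c' by auto
    then show ?thesis using c' True by simp
  next
    case False
    then show ?thesis using IH(2)[of c'] c' by auto
  qed
  then show ?case using IH(1) by auto
qed

lemma sweep_attained:
  "r \<le> m \<Longrightarrow> sweep B r c = B c \<or>
     (\<exists>c'. c < c' \<and> c' \<le> m \<and> RK c' < RK c \<and> sweep B r c = slab c c' + B c')"
proof (induction r)
  case (Suc r)
  then show ?case using CK[of "Suc r"] by (auto simp: max_def)
qed simp

lemma best_upper: "chain c cs \<Longrightarrow> length cs \<le> j \<Longrightarrow> val c cs \<le> best j c"
proof (induction j arbitrary: c cs)
  case (Suc j)
  show ?case
  proof (cases cs)
    case Nil
    have "0 \<le> best j c" using Suc.IH[of c "[]"] by simp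
    then show ?thesis using Nil sweep_upper[of m "best j" c] by simp
  next
    case (Cons c' cs')
    then show ?thesis
      using Suc.IH[of c' cs'] Suc.prems sweep_upper[of m "best j" c] RK[of c'] by force
  qed
qed simp

lemma best_attained: "\<exists>cs. chain c cs \<and> length cs \<le> j \<and> val c cs = best j c"
proof (induction j arbitrary: c)
  case (Suc j)
  from sweep_attained[of m "best j" c] consider
    "best (Suc j) c = best j c"
    | c' where "c < c'" "c' \<le> m" "RK c' < RK c" "best (Suc j) c = slab c c' + best j c'"
    by auto
  then show ?case
  proof cases
    case 1
    then show ?thesis using Suc.IH[of c] le_SucI by metis
  next
    case 2
    obtain cs where "chain c' cs" "length cs \<le> j" "val c' cs = best j c'" using Suc.IH by blast
    then show ?thesis using 2 by (intro exI[of _ "c' # cs"]) simp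
  qed
qed (auto intro: exI[of _ "[]"])

lemma chain_bounds: "chain c cs \<Longrightarrow> x \<in> set cs \<Longrightarrow> c < x \<and> x \<le> m \<and> RK x < RK c"
proof (induction cs arbitrary: c)
  case (Cons c' cs)
  then show ?case by force
qed simp

lemma chain_distinct: "chain c cs \<Longrightarrow> distinct cs"
proof (induction cs arbitrary: c)
  case (Cons c' cs)
  then show ?case using chain_bounds by fastforce
qed simp

lemma slab_points:
  "slab c c' = (\<Sum>p | p < n \<and> c < cx p \<and> cx p \<le> c' \<and> rp p \<le> RK c'. wt p)"
proof -
  have "(\<Sum>x\<in>{c<..c'}. \<Sum>p | p \<in> {p. p < n \<and> c < cx p \<and> cx p \<le> c' \<and> rp p \<le> RK c'} \<and> cx p = x. wt p)
      = (\<Sum>p | p < n \<and> c < cx p \<and> cx p \<le> c' \<and> rp p \<le> RK c'. wt p)"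
    by (intro sum.group) auto
  moreover have "colw (RK c') x =
      (\<Sum>p | p \<in> {p. p < n \<and> c < cx p \<and> cx p \<le> c' \<and> rp p \<le> RK c'} \<and> cx p = x. wt p)"
    if "x \<in> {c<..c'}" for x
    unfolding colw_def using that by (intro sum.cong) auto
  ultimately show ?thesis unfolding slab_def by simp
qed

text \<open>Cutting the dominated region at the columns of the chain: in the strip between two
  consecutive columns the right one dominates everything that any later one does, because its
  row is higher.\<close>

lemma val_points:
  "chain c cs \<Longrightarrow>
     val c cs = (\<Sum>p | p < n \<and> c < cx p \<and> (\<exists>x\<in>set cs. cx p \<le> x \<and> rp p \<le> RK x). wt p)"
proof (induction cs arbitrary: c)
  case (Cons c' cs)
  let ?A = "{p. p < n \<and> c < cx p \<and> cx p \<le> c' \<and> rp p \<le> RK c'}"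
  let ?B = "{p. p < n \<and> c' < cx p \<and> (\<exists>x\<in>set cs. cx p \<le> x \<and> rp p \<le> RK x)}"
  have ch: "c < c'" "RK c' < RK c" "chain c' cs" using Cons.prems by auto
  have b: "c' < x" "RK x < RK c'" if "x \<in> set cs" for x
    using chain_bounds[OF ch(3) that] by auto
  have "{p. p < n \<and> c < cx p \<and> (\<exists>x\<in>set (c' # cs). cx p \<le> x \<and> rp p \<le> RK x)} = ?A \<union> ?B"
    using ch b by (auto simp: not_le dest!: leI) (metis le_trans less_imp_le not_le)+
  moreover have "sum wt (?A \<union> ?B) = sum wt ?A + sum wt ?B"
    by (intro sum.union_disjoint) auto
  ultimately show ?case using Cons.IH[OF ch(3)] slab_points[of c c'] by simp
qed simp

lemma dominating_chain:
  assumes "finite C"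
  shows "C \<subseteq> {1..m} \<Longrightarrow> \<forall>x\<in>C. c < x \<and> RK x < RK c \<Longrightarrow>
    \<exists>cs. chain c cs \<and> set cs \<subseteq> C \<and> (\<forall>x\<in>C. \<exists>y\<in>set cs. x \<le> y \<and> RK x \<le> RK y)"
  using assms
proof (induction C arbitrary: c rule: finite_linorder_min_induct)
  case empty
  then show ?case by (intro exI[of _ "[]"]) simp
next
  case (insert b A)
  show ?case
  proof (cases "\<exists>a\<in>A. RK b < RK a")
    case True
    obtain cs where "chain c cs" "set cs \<subseteq> A" "\<forall>x\<in>A. \<exists>y\<in>set cs. x \<le> y \<and> RK x \<le> RK y"
      using insert.IH[of c] insert.prems by auto
    then show ?thesis using True insert.hyps
      by (intro exI[of _ cs]) (auto, metis le_trans less_imp_le)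
  next
    case False
    have "RK b \<noteq> RK a" if "a \<in> A" for a
    proof
      assume "RK b = RK a"
      moreover have "CK (RK a) = a" "CK (RK b) = b" using RK insert.prems that by auto
      ultimately show False using insert.hyps that by auto
    qed
    then have "\<forall>a\<in>A. b < a \<and> RK a < RK b" using False insert.hyps by (meson linorder_neqE_nat)
    then obtain cs where "chain b cs" "set cs \<subseteq> A" "\<forall>x\<in>A. \<exists>y\<in>set cs. x \<le> y \<and> RK x \<le> RK y"
      using insert.IH[of b] insert.prems by auto
    then show ?thesis using insert.prems by (intro exI[of _ "b # cs"]) auto
  qed
qed

definition covered :: "nat set \<Rightarrow> real" where
  "covered C = (\<Sum>p | p < n \<and> (\<exists>x\<in>C. cx p \<le> x \<and> rp p \<le> RK x). wt p)"

text \<open>Column 0 is a start that any column may follow, by \<open>RK_0\<close>, and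
  \<open>cx_pos\<close> places every point to its right. The dominating chain covers the same points
  as \<open>C\<close>, and it has no repetitions, so its length is at most
  \<open>card C\<close>.\<close>

lemma best_covered_upper:
  assumes "C \<subseteq> {1..m}" "card C \<le> k"
  shows "covered C \<le> best k 0"
proof -
  have "finite C" using assms finite_subset by blast
  moreover have "\<forall>x\<in>C. 0 < x \<and> RK x < RK 0" using assms RK RK_0 by fastforce
  ultimately obtain cs where cs: "chain 0 cs" "set cs \<subseteq> C"
    "\<forall>x\<in>C. \<exists>y\<in>set cs. x \<le> y \<and> RK x \<le> RK y"
    using dominating_chain[OF _ assms(1)] by blast
  have "length cs \<le> k"
    using card_mono[OF \<open>finite C\<close> cs(2)] distinct_card[OF chain_distinct[OF cs(1)]] assms(2) by simp
  moreover have "covered C = val 0 cs"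
    unfolding covered_def val_points[OF cs(1)] using cs(2,3) cx_pos
    by (intro sum.cong) (auto, (meson le_trans subsetD)+)
  ultimately show ?thesis using best_upper cs(1) by metis
qed

lemma best_covered_attained:
  "\<exists>C. C \<subseteq> {1..m} \<and> card C \<le> k \<and> covered C = best k 0"
proof -
  obtain cs where cs: "chain 0 cs" "length cs \<le> k" "val 0 cs = best k 0"
    using best_attained by blast
  have "covered (set cs) = val 0 cs"
    unfolding covered_def val_points[OF cs(1)] using cx_pos by simp
  moreover have "set cs \<subseteq> {1..m}" using chain_bounds[OF cs(1)] by force
  ultimately show ?thesis using cs card_length[of cs] by (metis le_trans)
qed

end

subsection \<open>Ranking and locating in memory\<close>

definition inc :: "nat \<Rightarrow> com" where "inc v = VSet v (WAdd (Var v) (WLit 1))"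

text \<open>Programs have no equality test on reals: once the first test has failed, the negated
  reverse comparison means equality, and then the index decides.\<close>

definition count_below :: "(wexp \<Rightarrow> rexp) \<Rightarrow> nat \<Rightarrow> com" where
  "count_below f v =
     Cond (RLess (f (Var 5)) (f (Var 4))) (inc v)
       (Cond (BAnd (BNot (RLess (f (Var 4)) (f (Var 5)))) (WLess (Var 5) (Var 4))) (inc v) Skip)"

definition rank_prog :: com where
  "rank_prog =
     For 4 mV (
       VSet 6 (WLit 1) ;; VSet 7 (WLit 1) ;;
       For 5 mV (count_below QX 6 ;; count_below QY 7) ;;
       RSet 2 (Var 6) (QX (Var 4)) ;; RSet 3 (Var 7) (QY (Var 4)) ;;
       WSet 16 (Var 6) (Var 7) ;; WSet 17 (Var 7) (Var 6)) ;;
     WSet 16 (WLit 0) (WAdd mV (WLit 1))"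

lemma card_less_Suc_if:
  "card {j. j < Suc i \<and> P j} = (if P i then Suc (card {j. j < i \<and> P j}) else card {j. j < i \<and> P j})"
proof -
  have "{j. j < Suc i \<and> P j} = (if P i then insert i {j. j < i \<and> P j} else {j. j < i \<and> P j})"
    by (auto simp: less_Suc_eq)
  then show ?thesis by simp
qed

context ram
begin

definition rx :: "nat \<Rightarrow> nat" where "rx i = rank (\<lambda>i. xq i) m i"
definition ry :: "nat \<Rightarrow> nat" where "ry i = rank (\<lambda>i. yq i) m i"

lemma m_less_W: "m < W" "Suc m < W"
  using S SW by auto

lemma run_count_below:
  assumes "wfs s" "wv s 4 0 = i" "i < m" "wv s 6 0 = 1" "wv s 7 0 = 1"
    and post: "\<And>t' s'. wfs s' \<Longrightarrow> t' \<le> t + 200 * m + 10 \<Longrightarrow> rv s' = rv s \<Longrightarrow>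
      \<forall>a. a \<noteq> 5 \<and> a \<noteq> 6 \<and> a \<noteq> 7 \<longrightarrow> wv s' a = wv s a \<Longrightarrow>
      wv s' 6 0 = rx i \<Longrightarrow> wv s' 7 0 = ry i \<Longrightarrow> Q t' s'"
  shows "run s (For 5 mV (count_below QX 6 ;; count_below QY 7)) t Q"
proof (rule run_For[where N = m and I = "\<lambda>j t' s'. t' \<le> t + 200 * j + 3 \<and> rv s' = rv s \<and>
      (\<forall>a. a \<noteq> 5 \<and> a \<noteq> 6 \<and> a \<noteq> 7 \<longrightarrow> wv s' a = wv s a) \<and>
      wv s' 6 0 = Suc (card {j'. j' < j \<and> (xq j' < xq i \<or> xq j' = xq i \<and> j' < i)}) \<and>
      wv s' 7 0 = Suc (card {j'. j' < j \<and> (yq j' < yq i \<or> yq j' = yq i \<and> j' < i)})"])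
  fix j t' s'
  assume "wfs s'" "j < m" and I: "t' \<le> t + 200 * j + 3 \<and> rv s' = rv s \<and>
      (\<forall>a. a \<noteq> 5 \<and> a \<noteq> 6 \<and> a \<noteq> 7 \<longrightarrow> wv s' a = wv s a) \<and>
      wv s' 6 0 = Suc (card {j'. j' < j \<and> (xq j' < xq i \<or> xq j' = xq i \<and> j' < i)}) \<and>
      wv s' 7 0 = Suc (card {j'. j' < j \<and> (yq j' < yq i \<or> yq j' = yq i \<and> j' < i)})"
    and "wv s' 5 0 = j"
  have *: "card {j'. j' < j \<and> P j'} \<le> j" for P
    using card_mono[of "{..<j}" "{j'. j' < j \<and> P j'}"] by auto
  have W: "j < W" "Suc j < W" "i < W" "Suc (Suc j) < W"
    using m_less_W \<open>j < m\<close> assms(3) by auto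
  have 2: "Suc (Suc (card {j'. j' < j \<and> P j'})) < W" for P
    using *[of P] W by linarith
  have 3: "Suc (card {j'. j' < j \<and> P j'}) < W" for P
    using *[of P] W by linarith
  show "run s' (count_below QX 6 ;; count_below QY 7) (t' + (wcost mV + 4))
        (\<lambda>t' s'. wfs s' \<and> wv s' 5 0 = j \<and> t' + 6 \<le> t + 200 * Suc j + 3 \<and>
          rv (wset 5 0 (Suc j) s') = rv s \<and>
      (\<forall>a. a \<noteq> 5 \<and> a \<noteq> 6 \<and> a \<noteq> 7 \<longrightarrow> wv (wset 5 0 (Suc j) s') a = wv s a) \<and>
      wv (wset 5 0 (Suc j) s') 6 0 = Suc (card {j'. j' < Suc j \<and> (xq j' < xq i \<or> xq j' = xq i \<and> j' < i)}) \<and>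
      wv (wset 5 0 (Suc j) s') 7 0 = Suc (card {j'. j' < Suc j \<and> (yq j' < yq i \<or> yq j' = yq i \<and> j' < i)}))"
    using I assms \<open>wfs s'\<close> \<open>j < m\<close> \<open>wv s' 5 0 = j\<close> W
    by (auto simp: count_below_def inc_def run_simps card_less_Suc_if 2 3)
qed (use assms in \<open>auto simp: rx_def ry_def rank_def\<close>)


definition ranked :: "state \<Rightarrow> bool" where
  "ranked s \<longleftrightarrow> wv s 16 0 = Suc m \<and>
     (\<forall>i<m. rv s 2 (rx i) = xq i \<and> rv s 3 (ry i) = yq i \<and> wv s 16 (rx i) = ry i \<and> wv s 17 (ry i) = rx i)"

lemma rx_range: "i < m \<Longrightarrow> 0 < rx i \<and> rx i \<le> m"
  using rank_range[of i m "\<lambda>i. xq i"] by (simp add: rx_def)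

lemma ry_range: "i < m \<Longrightarrow> 0 < ry i \<and> ry i \<le> m"
  using rank_range[of i m "\<lambda>i. yq i"] by (simp add: ry_def)

text \<open>Index 0 is never a rank, so the final write of the sentinel row to array 16 leaves the
  entries for \<open>Q\<close> intact.\<close>

lemma rank_pos [simp]: "i < m \<Longrightarrow> rx i \<noteq> 0" "i < m \<Longrightarrow> ry i \<noteq> 0"
  using rx_range ry_range by blast+

lemma rx_eq: "i < m \<Longrightarrow> j < m \<Longrightarrow> rx i = rx j \<longleftrightarrow> i = j"
  using inj_on_eq_iff[OF bij_betw_imp_inj_on[OF rank_bij], of i m j "\<lambda>i. xq i"] by (simp add: rx_def)

lemma ry_eq: "i < m \<Longrightarrow> j < m \<Longrightarrow> ry i = ry j \<longleftrightarrow> i = j"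
  using inj_on_eq_iff[OF bij_betw_imp_inj_on[OF rank_bij], of i m j "\<lambda>i. yq i"] by (simp add: ry_def)

lemma run_rank:
  assumes "wfs s"
    and post: "\<And>t' s'. wfs s' \<Longrightarrow> t' \<le> t + m * (200 * m + 200) + 100 \<Longrightarrow> ranked s' \<Longrightarrow> Q t' s'"
  shows "run s rank_prog t Q"
proof -
  define I where "I = (\<lambda>i t' s'. t' \<le> t + i * (200 * m + 200) + 3 \<and>
     (\<forall>j<i. rv s' 2 (rx j) = xq j \<and> rv s' 3 (ry j) = yq j \<and> wv s' 16 (rx j) = ry j \<and> wv s' 17 (ry j) = rx j))"
  show ?thesis
    unfolding rank_prog_def ok_Seq[of _ _ _ "For _ _ _"]
  proof (rule run_For[where N = m and I = I])
    fix i t' s'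
    assume *: "wfs s'" "i < m" "Suc i < W" "I i t' s'" "wv s' 4 0 = i"
    have W: "rx i < W" "ry i < W" "rx i \<le> n + m + 1" "ry i \<le> n + m + 1"
      using rx_range ry_range *(2) m_less_W by (meson le_less_trans le_trans le_add1 le_add2)+
    show "run s' (VSet 6 (WLit 1) ;; VSet 7 (WLit 1) ;;
       For 5 mV (count_below QX 6 ;; count_below QY 7) ;;
       RSet 2 (Var 6) (QX (Var 4)) ;; RSet 3 (Var 7) (QY (Var 4)) ;;
       WSet 16 (Var 6) (Var 7) ;; WSet 17 (Var 7) (Var 6)) (t' + (wcost mV + 4))
        (\<lambda>t' s'. wfs s' \<and> wv s' 4 0 = i \<and> I (Suc i) (t' + 6) (wset 4 0 (Suc i) s'))"
      using *(1,2,5) apply (simp add: run_simps)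
      apply (rule run_count_below[where i = i])
           apply simp_all[5]
      using W *(3,4) apply (auto simp: run_simps I_def less_Suc_eq rx_eq ry_eq)
      done
  qed (use assms m_less_W in \<open>auto simp: I_def run_simps ranked_def intro!: post\<close>)
qed

end

section \<open>Binary search for positions\<close>

definition search_prog :: "nat \<Rightarrow> rexp \<Rightarrow> com" where
  "search_prog a f =
     VSet 8 (WLit 1) ;; VSet 9 (WAdd mV (WLit 1)) ;;
     While (WLess (Var 8) (Var 9)) (
       VSet 10 (WDiv (WAdd (Var 8) (Var 9)) (WLit 2)) ;;
       Cond (RLess (RArr a (Var 10)) f) (VSet 8 (WAdd (Var 10) (WLit 1))) (VSet 9 (Var 10)))"

lemma rank_onto: "1 \<le> c \<Longrightarrow> c \<le> m \<Longrightarrow> \<exists>i<m. rank f m i = c"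
  using bij_betw_imp_surj_on[OF rank_bij, of f m] by (metis atLeastAtMost_iff imageE lessThan_iff)

text \<open>A threshold in {1..m+1} is determined by the ranks at or above it: of two distinct
  candidates the smaller is at most \<open>m\<close>, hence the rank of some \<open>i\<close>, and
  this rank lies at or above only one of them.\<close>

lemma position_eqI:
  assumes "1 \<le> l" "l \<le> Suc m" and l: "\<And>i. i < m \<Longrightarrow> l \<le> rank f m i \<longleftrightarrow> v \<le> f i"
  shows "position f m v = l"
proof (rule ccontr)
  let ?p = "position f m v"
  assume "?p \<noteq> l"
  moreover have p: "1 \<le> ?p" "?p \<le> Suc m" using position_range[of f m v] by auto
  ultimately have c: "1 \<le> min ?p l" "min ?p l \<le> m" using assms by auto
  then obtain i where i: "i < m" "rank f m i = min ?p l" using rank_onto by blast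
  then have "?p \<le> min ?p l \<longleftrightarrow> l \<le> min ?p l" using l[of i] position_le_rank[of i m f v] by simp
  then show False using \<open>?p \<noteq> l\<close> by auto
qed

context ram
begin

text \<open>\<open>f\<close> is evaluated anew at each probe, so its value must not depend on the
  search registers; it may use the input and cell 4, the index of the point being located.\<close>

lemma run_search:
  assumes "wfs s" "a < 8" and D: "m < 2 ^ D"
    and A: "\<And>i. i < m \<Longrightarrow> rv s a (rank g m i) = g i"
    and f: "\<And>s'. wfs s' \<Longrightarrow> wv s' 4 0 = wv s 4 0 \<Longrightarrow> rlegal S W s' f \<and> rval s' f = v" "rcost f \<le> 10"
    and post: "\<And>t' s'. wfs s' \<Longrightarrow> t' \<le> t + 100 * D + 100 \<Longrightarrow> rv s' = rv s \<Longrightarrow>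
      \<forall>a. a \<noteq> 8 \<and> a \<noteq> 9 \<and> a \<noteq> 10 \<longrightarrow> wv s' a = wv s a \<Longrightarrow>
      wv s' 8 0 = position g m v \<Longrightarrow> Q t' s'"
  shows "run s (search_prog a f) t Q"
proof -
  have mono: "rv s a c \<le> rv s a c'" if c: "1 \<le> c" "c \<le> c'" "c' \<le> m" for c c'
  proof -
    obtain i where i: "i < m" "rank g m i = c" using rank_onto[of c m g] c by auto
    obtain j where j: "j < m" "rank g m j = c'" using rank_onto[of c' m g] c by auto
    have "\<not> rank g m j < rank g m i" using i j c by simp
    then have "\<not> g j < g i" using rank_less_iff[of j m i g] i(1) j(1) by blast
    then show ?thesis using A[of i] A[of j] i j by simp
  qed
  \<comment> \<open>\<open>d\<close> is the number of halvings left: \<open>hi - lo\<close> is below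
    2^d, and initially it is m < 2^D. The answer may be m + 1, so \<open>hi\<close> starts one
    beyond the last rank.\<close>
  define I where "I = (\<lambda>d t' s'. wfs s' \<and> 1 \<le> wv s' 8 0 \<and> wv s' 8 0 \<le> wv s' 9 0 \<and>
    wv s' 9 0 \<le> m + 1 \<and> wv s' 9 0 < wv s' 8 0 + 2 ^ d \<and> t' + 100 * d \<le> t + 100 * D + 20 \<and>
    (\<forall>c. 1 \<le> c \<and> c < wv s' 8 0 \<longrightarrow> rv s a c < v) \<and>
    (\<forall>c. wv s' 9 0 \<le> c \<and> c \<le> m \<longrightarrow> v \<le> rv s a c) \<and>
    rv s' = rv s \<and> (\<forall>a. a \<noteq> 8 \<and> a \<noteq> 9 \<and> a \<noteq> 10 \<longrightarrow> wv s' a = wv s a))"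
  have W: "2 * (m + 1) < W" using S SW by simp
  let ?b = "WLess (Var 8) (Var 9)"
  let ?c = "VSet 10 (WDiv (WAdd (Var 8) (Var 9)) (WLit 2)) ;;
       Cond (RLess (RArr a (Var 10)) f) (VSet 8 (WAdd (Var 10) (WLit 1))) (VSet 9 (Var 10))"
  have "run (wset 9 0 (Suc m) (wset 8 0 1 s)) (While ?b ?c) (t + 9) Q"
  proof (rule ok_While[where I = I and n = D])
    show "I D (t + 9) (wset 9 0 (Suc m) (wset 8 0 1 s))"
      using assms(1,2) D m_less_W by (auto simp: I_def)
  next
    fix d t' s' assume I: "I d t' s'"
    define lo hi where "lo = wv s' 8 0" and "hi = wv s' 9 0"
    have I': "wfs s'" "1 \<le> lo" "lo \<le> hi" "hi \<le> m + 1" "hi < lo + 2 ^ d"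
      "t' + 100 * d \<le> t + 100 * D + 20"
      "\<And>c. 1 \<le> c \<Longrightarrow> c < lo \<Longrightarrow> rv s a c < v" "\<And>c. hi \<le> c \<Longrightarrow> c \<le> m \<Longrightarrow> v \<le> rv s a c"
      "rv s' = rv s" "\<And>a. a \<noteq> 8 \<and> a \<noteq> 9 \<and> a \<noteq> 10 \<Longrightarrow> wv s' a = wv s a"
      using I unfolding I_def lo_def hi_def by blast+
    have step: "0 < d \<and> run s' ?c (t' + (1 + bcost ?b)) (I (d - 1))" if "lo < hi"
    proof
      show "0 < d" using I'(5) that by (cases d) auto
      then obtain e where e: "d = Suc e" by (cases d) auto
      define mid where "mid = (lo + hi) div 2"
      have mid: "lo \<le> mid" "mid < hi" "mid \<le> m" "1 \<le> mid" "hi < mid + 1 + 2 ^ e" "mid < lo + 2 ^ e"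
        using that I'(2-5) by (auto simp: mid_def e)
      have lo_mid: "rv s a c < v" if "1 \<le> c" "c \<le> mid" "rv s a mid < v" for c
        using mono[of c mid] that mid by simp
      have hi_mid: "v \<le> rv s a c" if "mid \<le> c" "c \<le> m" "\<not> rv s a mid < v" for c
        using mono[of mid c] that mid by simp
      have W': "lo + hi < W" "2 < W" "mid < W" "Suc mid < W" "mid \<le> n + m + 1"
        using W I'(3,4) mid(3) S SW by auto
      have frame: "\<forall>a. a \<noteq> 8 \<and> a \<noteq> 9 \<and> a \<noteq> 10 \<longrightarrow> wv s' a = wv s a" using I'(10) by blast
      have right: "I e t1 (wset 8 0 (Suc mid) (wset 10 0 mid s'))"
        if "rv s a mid < v" "t1 \<le> t' + 100" for t1
        unfolding I_def
      proof (intro conjI)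
        show "\<forall>c. 1 \<le> c \<and> c < wv (wset 8 0 (Suc mid) (wset 10 0 mid s')) 8 0 \<longrightarrow> rv s a c < v"
          using lo_mid that(1) by simp
        show "\<forall>c. wv (wset 8 0 (Suc mid) (wset 10 0 mid s')) 9 0 \<le> c \<and> c \<le> m \<longrightarrow> v \<le> rv s a c"
          using I'(8) by (simp add: hi_def)
      qed (use I'(1,4,6,9) frame W' mid that(2) in \<open>simp_all add: e hi_def[symmetric]\<close>)
      have left: "I e t1 (wset 9 0 mid (wset 10 0 mid s'))"
        if "\<not> rv s a mid < v" "t1 \<le> t' + 100" for t1
        unfolding I_def
      proof (intro conjI)
        show "\<forall>c. 1 \<le> c \<and> c < wv (wset 9 0 mid (wset 10 0 mid s')) 8 0 \<longrightarrow> rv s a c < v"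
          using I'(7) by (simp add: lo_def)
        show "\<forall>c. wv (wset 9 0 mid (wset 10 0 mid s')) 9 0 \<le> c \<and> c \<le> m \<longrightarrow> v \<le> rv s a c"
          using hi_mid that(1) by simp
      qed (use I'(1,2,4,6,9) frame W' mid that(2) in \<open>simp_all add: e lo_def[symmetric]\<close>)
      have f': "rlegal S W (wset 10 0 mid s') f \<and> rval (wset 10 0 mid s') f = v"
        using frame I'(1) W' by (intro f(1)) auto
      show "run s' ?c (t' + (1 + bcost ?b)) (I (d - 1))"
        using I'(1,9) assms(2) f(2) W' f' left right
        by (simp add: run_simps lo_def[symmetric] hi_def[symmetric] mid_def[symmetric] e)
    qed
    have fin: "Q (t' + (1 + bcost ?b)) s'" if "\<not> lo < hi"
    proof (rule post)
      have "lo = hi" using that I'(3) by simp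
      have "position g m v = lo"
      proof (rule position_eqI)
        fix i assume "i < m"
        then show "lo \<le> rank g m i \<longleftrightarrow> v \<le> g i"
          using I'(7)[of "rank g m i"] I'(8)[of "rank g m i"] A[of i] rank_range[of i m g] \<open>lo = hi\<close>
          by (auto simp: not_le[symmetric])
      qed (use I' in auto)
      then show "wv s' 8 0 = position g m v" by (simp add: lo_def)
    qed (use I' in auto)
    show "blegal S W s' ?b \<and> (if bval s' ?b then 0 < d \<and> run s' ?c (t' + (1 + bcost ?b)) (I (d - 1))
           else Q (t' + (1 + bcost ?b)) s')"
      using step fin I'(1) unfolding lo_def hi_def by (simp del: bcost.simps)
  qed
  then show ?thesis
    using assms(1) m_less_W by (simp add: search_prog_def run_simps eval_nat_numeral)
qed

end

subsection \<open>Aggregating the weighted points\<close>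

text \<open>Loop counters start at 0, but items and rows are numbered from 1, since 0 ends a list
  and ranks start at 1.\<close>

definition succ_i :: wexp where "succ_i = WAdd (Var 4) (WLit 1)"

definition locate_prog :: com where
  "locate_prog = search_prog 2 (PX (Var 4)) ;; VSet 13 (Var 8) ;; search_prog 3 (PY (Var 4))"

definition point_items_prog :: com where
  "point_items_prog =
     VSet 14 nV ;;
     For 4 nV (locate_prog ;; WSet 18 succ_i (Var 13) ;; WSet 19 succ_i (Var 8) ;;
       RSet 4 succ_i (PW (Var 4)))"

text \<open>Cells are numbered row by row; \<open>i - (i div m) * m\<close> replaces the missing
  remainder operation. A point whose position is m + 1 on some axis is dominated by no point of
  \<open>Q\<close> and is left out.\<close>

definition grid_items_prog :: com where
  "grid_items_prog =
     VSet 14 (WMul mV mV) ;;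
     For 4 (Var 14) (
       WSet 18 succ_i (WAdd (WSub (Var 4) (WMul (WDiv (Var 4) mV) mV)) (WLit 1)) ;;
       WSet 19 succ_i (WAdd (WDiv (Var 4) mV) (WLit 1)) ;;
       RSet 4 succ_i (RLit 0)) ;;
     For 4 nV (locate_prog ;;
       Cond (BAnd (BNot (WLess mV (Var 13))) (BNot (WLess mV (Var 8))))
         (VSet 11 (WAdd (WMul (WSub (Var 8) (WLit 1)) mV) (Var 13)) ;;
          RSet 4 (Var 11) (RAdd (RArr 4 (Var 11)) (PW (Var 4))))
         Skip)"

definition items_prog :: com where
  "items_prog = Cond (WLess (WMul mV mV) nV) grid_items_prog point_items_prog"

lemma less_Suc_sum:
  "(\<Sum>p | p < Suc i \<and> P p. f p) = (\<Sum>p | p < i \<and> P p. f p) + (if P i then f i else (0::real))"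
proof -
  have "{p. p < Suc i \<and> P p} = (if P i then insert i {p. p < i \<and> P p} else {p. p < i \<and> P p})"
    by (auto simp: less_Suc_eq)
  then show ?thesis by simp
qed

lemma grid_index:
  fixes r c m :: nat
  assumes "1 \<le> r" "r \<le> m" "1 \<le> c" "c \<le> m"
  shows "((r - 1) * m + c - 1) mod m = c - 1" "((r - 1) * m + c - 1) div m = r - 1"
    "(r - 1) * m + c \<le> m * m"
proof -
  obtain r' c' where "r = Suc r'" "c = Suc c'" using assms by (cases r; cases c) auto
  then show "((r - 1) * m + c - 1) mod m = c - 1" "((r - 1) * m + c - 1) div m = r - 1"
    using assms by auto
  have "(r - 1) * m + c \<le> (r - 1) * m + m" using assms by simp
  also have "\<dots> = r * m" using assms by (metis Suc_pred' add.commute mult_Suc One_nat_def Suc_le_lessD)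
  also have "\<dots> \<le> m * m" using assms by simp
  finally show "(r - 1) * m + c \<le> m * m" .
qed

context ram
begin

definition cx :: "nat \<Rightarrow> nat" where "cx p = position (\<lambda>i. xq i) m (xp p)"
definition cy :: "nat \<Rightarrow> nat" where "cy p = position (\<lambda>i. yq i) m (yp p)"

lemma cx_range: "1 \<le> cx p" "cx p \<le> Suc m" using position_range[of "\<lambda>i. xq i" m "xp p"] by (auto simp: cx_def)
lemma cy_range: "1 \<le> cy p" "cy p \<le> Suc m" using position_range[of "\<lambda>i. yq i" m "yp p"] by (auto simp: cy_def)

text \<open>Only the total weight of each cell with row and column at most \<open>m\<close> matters,
  which lets single points and merged cells meet one specification. Points stored singly may lie
  beyond \<open>Q\<close> and then carry coordinate m + 1, hence the range up to
  \<open>Suc m\<close>.\<close>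

definition items :: "state \<Rightarrow> bool" where
  "items s \<longleftrightarrow> wv s 14 0 \<le> n \<and> wv s 14 0 \<le> m * m \<and>
     (\<forall>e\<in>{1..wv s 14 0}. 1 \<le> wv s 18 e \<and> wv s 18 e \<le> Suc m \<and> 1 \<le> wv s 19 e \<and> wv s 19 e \<le> Suc m) \<and>
     (\<forall>c\<in>{1..m}. \<forall>r\<in>{1..m}. (\<Sum>e | e \<in> {1..wv s 14 0} \<and> wv s 18 e = c \<and> wv s 19 e = r. rv s 4 e) =
        (\<Sum>p | p < n \<and> cx p = c \<and> cy p = r. wp p))"

lemma run_locate:
  assumes "wfs s" "ranked s" "wv s 4 0 = i" "i < n" "m < 2 ^ D"
    and post: "\<And>t' s'. wfs s' \<Longrightarrow> t' \<le> t + 200 * D + 250 \<Longrightarrow> rv s' = rv s \<Longrightarrow>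
      \<forall>a. a \<noteq> 8 \<and> a \<noteq> 9 \<and> a \<noteq> 10 \<and> a \<noteq> 13 \<longrightarrow> wv s' a = wv s a \<Longrightarrow>
      wv s' 13 0 = cx i \<Longrightarrow> wv s' 8 0 = cy i \<Longrightarrow> Q t' s'"
  shows "run s locate_prog t Q"
  unfolding locate_prog_def run_Seq
proof (rule run_search[where D = D and g = "\<lambda>i. xq i" and v = "xp i"])
  fix t1 s1
  assume 1: "wfs s1" "t1 \<le> t + 100 * D + 100" "rv s1 = rv s"
    "\<forall>a. a \<noteq> 8 \<and> a \<noteq> 9 \<and> a \<noteq> 10 \<longrightarrow> wv s1 a = wv s a"
    "wv s1 8 0 = position (\<lambda>i. xq i) m (xp i)"
  have W: "cx i < W" using cx_range[of i] m_less_W by linarith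
  have "run (wset 13 0 (cx i) s1) (search_prog 3 (PY (Var 4))) (t1 + 4) Q"
  proof (rule run_search[where D = D and g = "\<lambda>i. yq i" and v = "yp i"])
    fix t2 s2
    assume "wfs s2" "t2 \<le> t1 + 4 + 100 * D + 100" "rv s2 = rv (wset 13 0 (cx i) s1)"
      "\<forall>a. a \<noteq> 8 \<and> a \<noteq> 9 \<and> a \<noteq> 10 \<longrightarrow> wv s2 a = wv (wset 13 0 (cx i) s1) a"
      "wv s2 8 0 = position (\<lambda>i. yq i) m (yp i)"
    then show "Q t2 s2" using 1 by (intro post) (auto simp: cy_def)
  qed (use 1 assms W in \<open>auto simp: ranked_def ry_def\<close>)
  then show "run s1 (VSet 13 (Var 8)) t1 (\<lambda>t s. run s (search_prog 3 (PY (Var 4))) t Q)"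
    using 1 by (simp add: run_simps cx_def add.commute)
qed (use assms in \<open>auto simp: ranked_def rx_def\<close>)

lemma succ_i_simps [simp]:
  "wcost succ_i = 4" "wval s succ_i = Suc (wv s 4 0)"
  "wfs s \<Longrightarrow> wlegal S W s succ_i \<longleftrightarrow> Suc (wv s 4 0) < W"
  by (auto simp: succ_i_def)

lemma run_point_items:
  assumes "wfs s" "ranked s" "m < 2 ^ D" "n \<le> m * m"
    and post: "\<And>t' s'. wfs s' \<Longrightarrow> t' \<le> t + n * (200 * D + 400) + 100 \<Longrightarrow> ranked s' \<Longrightarrow> items s' \<Longrightarrow> Q t' s'"
  shows "run s point_items_prog t Q"
proof -
  define I where "I = (\<lambda>i t' s'. t' \<le> t + i * (200 * D + 400) + 10 \<and> ranked s' \<and> wv s' 14 0 = n \<and>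
    (\<forall>p<i. wv s' 18 (Suc p) = cx p \<and> wv s' 19 (Suc p) = cy p \<and> rv s' 4 (Suc p) = wp p))"
  have nW: "n < W" using S SW by simp
  have "run (wset 14 0 n s) (For 4 nV (locate_prog ;; WSet 18 succ_i (Var 13) ;; WSet 19 succ_i (Var 8) ;;
       RSet 4 succ_i (PW (Var 4)))) (t + 4) Q"
  proof (rule run_For[where N = n and I = I])
    fix i t' s'
    assume *: "wfs s'" "i < n" "Suc i < W" "I i t' s'" "wv s' 4 0 = i"
    show "run s' (locate_prog ;; WSet 18 succ_i (Var 13) ;; WSet 19 succ_i (Var 8) ;; RSet 4 succ_i (PW (Var 4)))
        (t' + (wcost nV + 4)) (\<lambda>t s. wfs s \<and> wv s 4 0 = i \<and> I (Suc i) (t + 6) (wset 4 0 (Suc i) s))"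
      unfolding run_Seq[of _ locate_prog]
    proof (rule run_locate[where i = i and D = D])
      fix t1 s1
      assume 1: "wfs s1" "t1 \<le> t' + (wcost nV + 4) + 200 * D + 250" "rv s1 = rv s'"
        "\<forall>a. a \<noteq> 8 \<and> a \<noteq> 9 \<and> a \<noteq> 10 \<and> a \<noteq> 13 \<longrightarrow> wv s1 a = wv s' a"
        "wv s1 13 0 = cx i" "wv s1 8 0 = cy i"
      have W: "cx i < W" "cy i < W" using cx_range[of i] cy_range[of i] m_less_W by linarith+
      show "run s1 (WSet 18 succ_i (Var 13) ;; WSet 19 succ_i (Var 8) ;; RSet 4 succ_i (PW (Var 4)))
         t1 (\<lambda>t s. wfs s \<and> wv s 4 0 = i \<and> I (Suc i) (t + 6) (wset 4 0 (Suc i) s))"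
        using 1 * W by (auto simp: run_simps I_def less_Suc_eq ranked_def)
    qed (use * assms in \<open>auto simp: I_def\<close>)
  next
    fix t' s' assume *: "wfs s'" "I n t' s'"
    have items: "items s'"
      unfolding items_def
    proof (intro conjI ballI)
      fix c r
      have "(\<Sum>e | e \<in> {1..n} \<and> wv s' 18 e = c \<and> wv s' 19 e = r. rv s' 4 e) =
        (\<Sum>p | p < n \<and> cx p = c \<and> cy p = r. wp p)"
      proof (rule sum.reindex_bij_witness[where i = Suc and j = "\<lambda>e. e - 1"])
        fix e assume e: "e \<in> {e. e \<in> {1..n} \<and> wv s' 18 e = c \<and> wv s' 19 e = r}"
        then obtain p where "e = Suc p" "p < n" by (cases e) auto
        then show "Suc (e - 1) = e" "e - 1 \<in> {p. p < n \<and> cx p = c \<and> cy p = r}" "wp (e - 1) = rv s' 4 e"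
          using e * by (auto simp: I_def)
      qed (use * in \<open>auto simp: I_def\<close>)
      then show "(\<Sum>e | e \<in> {1..wv s' 14 0} \<and> wv s' 18 e = c \<and> wv s' 19 e = r. rv s' 4 e) =
        (\<Sum>p | p < n \<and> cx p = c \<and> cy p = r. wp p)" using * by (simp add: I_def)
    next
      fix e assume "e \<in> {1..wv s' 14 0}"
      then obtain p where "e = Suc p" "p < n" using * by (cases e) (auto simp: I_def)
      then show "1 \<le> wv s' 18 e" "wv s' 18 e \<le> Suc m" "1 \<le> wv s' 19 e" "wv s' 19 e \<le> Suc m"
        using * cx_range[of p] cy_range[of p] by (auto simp: I_def)
    qed (use * assms in \<open>auto simp: I_def\<close>)
    show "Q (t' + (wcost nV + 4)) s'"
      using * items by (intro post) (auto simp: I_def)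
  qed (use assms nW in \<open>auto simp: I_def ranked_def\<close>)
  then show ?thesis
    using assms(1) nW by (simp add: point_items_prog_def run_simps add.commute)
qed

lemma run_grid_items:
  assumes "wfs s" "ranked s" "m < 2 ^ D" "m * m < n" "0 < m"
    and post: "\<And>t' s'. wfs s' \<Longrightarrow> t' \<le> t + n * (200 * D + 600) + 100 \<Longrightarrow> ranked s' \<Longrightarrow> items s' \<Longrightarrow> Q t' s'"
  shows "run s grid_items_prog t Q"
proof -
  let ?body1 = "WSet 18 succ_i (WAdd (WSub (Var 4) (WMul (WDiv (Var 4) mV) mV)) (WLit 1)) ;;
       WSet 19 succ_i (WAdd (WDiv (Var 4) mV) (WLit 1)) ;;
       RSet 4 succ_i (RLit 0)"
  let ?body2 = "locate_prog ;;
       Cond (BAnd (BNot (WLess mV (Var 13))) (BNot (WLess mV (Var 8))))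
         (VSet 11 (WAdd (WMul (WSub (Var 8) (WLit 1)) mV) (Var 13)) ;;
          RSet 4 (Var 11) (RAdd (RArr 4 (Var 11)) (PW (Var 4))))
         Skip"
  define J where "J = (\<lambda>i s'. wv s' 14 0 = m * m \<and> ranked s' \<and>
    (\<forall>e<i. wv s' 18 (Suc e) = Suc (e mod m) \<and> wv s' 19 (Suc e) = Suc (e div m)))"
  define I1 where "I1 = (\<lambda>i t' s'. t' \<le> t + 100 * i + 20 \<and> J i s' \<and> (\<forall>e<i. rv s' 4 (Suc e) = 0))"
  define I2 where "I2 = (\<lambda>i t' s'. t' \<le> t + 100 * n + i * (200 * D + 400) + 50 \<and> J (m * m) s' \<and>
    (\<forall>c\<in>{1..m}. \<forall>r\<in>{1..m}. rv s' 4 ((r - 1) * m + c) = (\<Sum>p | p < i \<and> cx p = c \<and> cy p = r. wp p)))"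
  have mmW: "m * m < W" using mW by simp
  have "run (wset 14 0 (m * m) s) (For 4 (Var 14) ?body1) (t + 7) (\<lambda>t s. run s (For 4 nV ?body2) t Q)"
  proof (rule run_For[where N = "m * m" and I = I1])
    fix i t' s'
    assume *: "wfs s'" "i < m * m" "Suc i < W" "I1 i t' s'" "wv s' 4 0 = i"
    have d: "i div m < m" using *(2) by (simp add: less_mult_imp_div_less)
    have r: "i mod m < m" using assms by simp
    have W: "Suc (i div m) < W" "Suc (i mod m) < W" using d r m_less_W by linarith+
    have le: "i div m * m \<le> i" by simp
    show "run s' ?body1 (t' + (wcost (Var 14) + 4))
        (\<lambda>t s. wfs s \<and> wv s 4 0 = i \<and> I1 (Suc i) (t + 6) (wset 4 0 (Suc i) s))"
      using * assms W r d le_less_trans[OF le, of W]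
      by (auto simp: run_simps I1_def J_def less_Suc_eq ranked_def minus_div_mult_eq_mod)
  next
    fix t0 s0 assume 0: "wfs s0" "I1 (m * m) t0 s0"
    show "run s0 (For 4 nV ?body2) (t0 + (wcost (Var 14) + 4)) Q"
    proof (rule run_For[where N = n and I = I2])
      have "rv s0 4 ((r - 1) * m + c) = 0" if rc: "c \<in> {1..m}" "r \<in> {1..m}" for r c
      proof -
        have "(r - 1) * m + c \<le> m * m" using grid_index(3)[of r m c] rc by simp
        moreover obtain e where "(r - 1) * m + c = Suc e" using rc by (cases c) auto
        ultimately show ?thesis using 0(2) by (auto simp: I1_def)
      qed
      then show "I2 0 (t0 + (wcost (Var 14) + 4) + 3) (wset 4 0 0 s0)"
        using 0 assms by (auto simp: I1_def I2_def J_def ranked_def)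
    next
      fix i t' s'
      assume *: "wfs s'" "i < n" "Suc i < W" "I2 i t' s'" "wv s' 4 0 = i"
      show "run s' ?body2 (t' + (wcost nV + 4))
        (\<lambda>t s. wfs s \<and> wv s 4 0 = i \<and> I2 (Suc i) (t + 6) (wset 4 0 (Suc i) s))"
        unfolding run_Seq[of _ locate_prog]
      proof (rule run_locate[where i = i and D = D])
        fix t1 s1
        assume 1: "wfs s1" "t1 \<le> t' + (wcost nV + 4) + 200 * D + 250" "rv s1 = rv s'"
          "\<forall>a. a \<noteq> 8 \<and> a \<noteq> 9 \<and> a \<noteq> 10 \<and> a \<noteq> 13 \<longrightarrow> wv s1 a = wv s' a"
          "wv s1 13 0 = cx i" "wv s1 8 0 = cy i"
        have J1: "J (m * m) s1" using *(4) 1 by (auto simp: I2_def J_def ranked_def)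
        have R: "rv s1 4 ((r - 1) * m + c) = (\<Sum>p | p < i \<and> cx p = c \<and> cy p = r. wp p)"
          if "c \<in> {1..m}" "r \<in> {1..m}" for c r using *(4) that 1(3) by (auto simp: I2_def)
        have T: "t1 + 200 \<le> t + 100 * n + Suc i * (200 * D + 400) + 50 + 60" using *(4) 1(2) by (simp add: I2_def)
        show "run s1 (Cond (BAnd (BNot (WLess mV (Var 13))) (BNot (WLess mV (Var 8))))
           (VSet 11 (WAdd (WMul (WSub (Var 8) (WLit 1)) mV) (Var 13)) ;;
            RSet 4 (Var 11) (RAdd (RArr 4 (Var 11)) (PW (Var 4)))) Skip)
           t1 (\<lambda>t s. wfs s \<and> wv s 4 0 = i \<and> I2 (Suc i) (t + 6) (wset 4 0 (Suc i) s))"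
        proof (cases "cx i \<le> m \<and> cy i \<le> m")
          case True
          let ?e = "(cy i - 1) * m + cx i"
          have b: "?e \<le> m * m" using grid_index(3)[of "cy i" m "cx i"] True cx_range cy_range by simp
          \<comment> \<open>Here \<open>m * m < n\<close> makes the cell number a legal array
            index.\<close>
          have e: "?e < W" "?e \<le> n + m + 1" "(cy i - 1) * m < W" "cy i - 1 < W"
            using b mmW assms(4) True m_less_W by linarith+
          \<comment> \<open>Division by \<open>m\<close> recovers row and column from the cell
            number, so adding to this cell changes no other total.\<close>
          have inj: "(r - 1) * m + c = ?e \<longleftrightarrow> c = cx i \<and> r = cy i" if "c \<in> {1..m}" "r \<in> {1..m}" for c r
          proof
            assume eq: "(r - 1) * m + c = ?e"
            have "c - 1 = cx i - 1" "r - 1 = cy i - 1"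
              using grid_index(1,2)[of r m c] grid_index(1,2)[of "cy i" m "cx i"] that True
                cx_range[of i] cy_range[of i] unfolding eq by auto
            then show "c = cx i \<and> r = cy i" using that cx_range(1)[of i] cy_range(1)[of i] by auto
          qed simp
          have "I2 (Suc i) t2 (wset 4 0 (Suc i) (rset 4 ?e (rv s1 4 ?e + wp i) (wset 11 0 ?e s1)))"
            if "t2 \<le> t1 + 100" for t2
            unfolding I2_def
          proof (intro conjI ballI)
            fix c r assume cr: "c \<in> {1..m}" "r \<in> {1..m}"
            show "rv (wset 4 0 (Suc i) (rset 4 ?e (rv s1 4 ?e + wp i) (wset 11 0 ?e s1))) 4 ((r - 1) * m + c) =
               (\<Sum>p | p < Suc i \<and> cx p = c \<and> cy p = r. wp p)"
              using R[OF cr] by (auto simp: inj[OF cr, simplified] less_Suc_sum)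
          next
            show "J (m * m) (wset 4 0 (Suc i) (rset 4 ?e (rv s1 4 ?e + wp i) (wset 11 0 ?e s1)))"
              using J1 by (auto simp: J_def ranked_def)
          qed (use T that in simp)
          then show ?thesis
            using True 1 e *(2,3,5) m_less_W by (simp add: run_simps)
        next
          case False
          then have "I2 (Suc i) t2 (wset 4 0 (Suc i) s1)" if "t2 \<le> t1 + 100" for t2
            unfolding I2_def using that J1 R T by (auto simp: less_Suc_sum J_def ranked_def)
          then show ?thesis
            using False 1 *(2,3,5) by (auto simp: run_simps)
        qed
      qed (use * assms in \<open>auto simp: I2_def J_def\<close>)
    next
      fix t' s' assume *: "wfs s'" "I2 n t' s'"
      have J: "wv s' 14 0 = m * m"
        "\<And>e. e < m * m \<Longrightarrow> wv s' 18 (Suc e) = Suc (e mod m) \<and> wv s' 19 (Suc e) = Suc (e div m)"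
        using * by (auto simp: I2_def J_def)
      have items: "items s'"
        unfolding items_def
      proof (intro conjI ballI)
        fix c r assume cr: "c \<in> {1..m}" "r \<in> {1..m}"
        have "{e. e \<in> {1..m * m} \<and> wv s' 18 e = c \<and> wv s' 19 e = r} = {(r - 1) * m + c}"
        proof (intro equalityI subsetI)
          fix e assume "e \<in> {e. e \<in> {1..m * m} \<and> wv s' 18 e = c \<and> wv s' 19 e = r}"
          moreover then obtain e' where "e = Suc e'" by (cases e) auto
          ultimately have "c = Suc (e' mod m)" "r = Suc (e' div m)" "e = Suc e'" using J(2)[of e'] by auto
          then show "e \<in> {(r - 1) * m + c}" by simp
        next
          fix e assume e: "e \<in> {(r - 1) * m + c}"
          then obtain e' where e': "e = Suc e'" using cr by (cases c) auto
          then have "e' = (r - 1) * m + c - 1" using e by simp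
          then have "e' mod m = c - 1" "e' div m = r - 1"
            using grid_index(1,2)[of r m c] cr by auto
          moreover have "e' < m * m" using grid_index(3)[of r m c] cr e e' by auto
          ultimately show "e \<in> {e. e \<in> {1..m * m} \<and> wv s' 18 e = c \<and> wv s' 19 e = r}"
            using J(2)[of e'] cr e' by auto
        qed
        then show "(\<Sum>e | e \<in> {1..wv s' 14 0} \<and> wv s' 18 e = c \<and> wv s' 19 e = r. rv s' 4 e) =
          (\<Sum>p | p < n \<and> cx p = c \<and> cy p = r. wp p)"
          using * cr unfolding J by (simp add: I2_def)
      next
        fix e assume "e \<in> {1..wv s' 14 0}"
        then obtain e' where e': "e = Suc e'" "e' < m * m" using J(1) by (cases e) auto
        have "e' div m < m" using e' by (simp add: less_mult_imp_div_less)
        moreover have "e' mod m < m" using assms by simp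
        ultimately show "1 \<le> wv s' 18 e" "wv s' 18 e \<le> Suc m" "1 \<le> wv s' 19 e" "wv s' 19 e \<le> Suc m"
          using J(2)[of e'] e' by auto
      qed (use J assms in auto)
      show "Q (t' + (wcost nV + 4)) s'"
        using * items by (intro post) (auto simp: I2_def J_def algebra_simps)
    qed (use 0 in auto)
  qed (use assms mmW in \<open>auto simp: I1_def J_def ranked_def\<close>)
  then show ?thesis
    using assms(1) mmW by (simp add: grid_items_prog_def run_simps eval_nat_numeral)
qed

lemma run_items:
  assumes "wfs s" "ranked s" "m < 2 ^ D" "0 < m"
    and post: "\<And>t' s'. wfs s' \<Longrightarrow> t' \<le> t + n * (200 * D + 600) + 200 \<Longrightarrow> ranked s' \<Longrightarrow> items s' \<Longrightarrow> Q t' s'"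
  shows "run s items_prog t Q"
proof (cases "m * m < n")
  case True
  have "run s grid_items_prog (t + 9) Q"
    by (rule run_grid_items[OF assms(1-3) True assms(4)]) (auto intro!: post)
  then show ?thesis using assms(1) True mW by (simp add: items_prog_def run_simps eval_nat_numeral)
next
  case False
  have "run s point_items_prog (t + 9) Q"
    using False by (intro run_point_items[OF assms(1-3)]) (auto intro!: post simp: algebra_simps)
  then show ?thesis using assms(1) False mW by (simp add: items_prog_def run_simps eval_nat_numeral)
qed

end

section \<open>Grouping the items by row\<close>

definition clear_prog :: com where
  "clear_prog =
     For 4 (WAdd mV (WLit 2)) (
       WSet 21 (Var 4) (WLit 0) ;; RSet 5 (Var 4) (RLit 0) ;; RSet 6 (Var 4) (RLit 0) ;;
       RSet 7 (Var 4) (RLit 0))"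

text \<open>Each item is put in front of the list of its row. One link per item keeps all lists in
  linear space, and a row can be read in time proportional to its own items.\<close>

definition link_prog :: com where
  "link_prog =
     For 4 (Var 14) (
       WSet 20 succ_i (WArr 21 (WArr 19 succ_i)) ;; WSet 21 (WArr 19 succ_i) succ_i)"

fun linked_list :: "(nat \<Rightarrow> nat) \<Rightarrow> nat \<Rightarrow> nat list \<Rightarrow> bool" where
  "linked_list nx h [] \<longleftrightarrow> h = 0"
| "linked_list nx h (e # es) \<longleftrightarrow> h = e \<and> 0 < e \<and> linked_list nx (nx e) es"

text \<open>The link written for a new item belongs to no list built so far, since those contain
  smaller numbers only.\<close>

lemma linked_list_upd: "e \<notin> set es \<Longrightarrow> linked_list (nx(e := x)) h es \<longleftrightarrow> linked_list nx h es"
  by (induction es arbitrary: h) auto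

context ram
begin

definition cleared :: "state \<Rightarrow> bool" where
  "cleared s \<longleftrightarrow> (\<forall>c\<le>Suc m. rv s 5 c = 0 \<and> rv s 6 c = 0 \<and> rv s 7 c = 0)"

definition linked :: "state \<Rightarrow> bool" where
  "linked s \<longleftrightarrow> (\<forall>r\<le>Suc m. \<exists>es. linked_list (wv s 20) (wv s 21 r) es \<and> distinct es \<and>
     set es = {e \<in> {1..wv s 14 0}. wv s 19 e = r})"

lemma run_clear:
  assumes "wfs s" "ranked s" "items s"
    and post: "\<And>t' s'. wfs s' \<Longrightarrow> t' \<le> t + 100 * m + 300 \<Longrightarrow> ranked s' \<Longrightarrow> items s' \<Longrightarrow> cleared s' \<Longrightarrow>
      \<forall>r\<le>Suc m. wv s' 21 r = 0 \<Longrightarrow> Q t' s'"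
  shows "run s clear_prog t Q"
  unfolding clear_prog_def
proof (rule run_For[where N = "m + 2" and I = "\<lambda>i t' s'. t' \<le> t + 100 * i + 3 \<and> ranked s' \<and> items s' \<and>
   (\<forall>r<i. wv s' 21 r = 0 \<and> rv s' 5 r = 0 \<and> rv s' 6 r = 0 \<and> rv s' 7 r = 0)"], goal_cases)
  case (6 i t' s')
  then have "i < W" "i \<le> n + m + 1" by auto
  then show ?case using 6 S SW
    by (auto simp: run_simps ranked_def items_def less_Suc_eq)
next
  case (7 t' s')
  then show ?case by (intro post) (auto simp: cleared_def)
qed (use assms S SW in \<open>auto simp: ranked_def items_def\<close>)

lemma run_link:
  assumes "wfs s" "ranked s" "items s" "cleared s" "\<forall>r\<le>Suc m. wv s 21 r = 0"
    and post: "\<And>t' s'. wfs s' \<Longrightarrow> t' \<le> t + 100 * n + 100 \<Longrightarrow> ranked s' \<Longrightarrow> items s' \<Longrightarrow> cleared s' \<Longrightarrow>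
      linked s' \<Longrightarrow> Q t' s'"
  shows "run s link_prog t Q"
proof -
  define N where "N = wv s 14 0"
  have N: "N \<le> n" using assms(3) by (simp add: N_def items_def)
  define L where "L = (\<lambda>i s'. \<forall>r\<le>Suc m. \<exists>es. linked_list (wv s' 20) (wv s' 21 r) es \<and> distinct es \<and>
     set es = {e \<in> {1..i}. wv s' 19 e = r})"
  define I where "I = (\<lambda>i t' s'. t' \<le> t + 100 * i + 3 \<and> wv s' 14 0 = N \<and> ranked s' \<and> items s' \<and> cleared s' \<and> L i s')"
  show ?thesis
    unfolding link_prog_def
  proof (rule run_For[where N = N and I = I])
    show "I 0 (t + 3) (wset 4 0 0 s)"
      using assms by (auto simp: I_def L_def N_def ranked_def items_def cleared_def intro!: exI[of _ "[]"])
  next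
    fix i t' s'
    assume *: "wfs s'" "i < N" "Suc i < W" "I i t' s'" "wv s' 4 0 = i"
    define r0 where "r0 = wv s' 19 (Suc i)"
    have r0: "r0 \<le> Suc m"
      using *(2,4) by (auto simp: I_def items_def r0_def)
    define s2 where "s2 = wset 4 0 (Suc i) (wset 21 r0 (Suc i) (wset 20 (Suc i) (wv s' 21 r0) s'))"
    have "L (Suc i) s2"
      unfolding L_def
    proof (intro allI impI)
      fix r assume "r \<le> Suc m"
      then obtain es where es: "linked_list (wv s' 20) (wv s' 21 r) es" "distinct es"
          "set es = {e \<in> {1..i}. wv s' 19 e = r}"
        using *(4) by (auto simp: I_def L_def)
      have new: "Suc i \<notin> set es" using es by auto
      show "\<exists>es. linked_list (wv s2 20) (wv s2 21 r) es \<and> distinct es \<and>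
          set es = {e \<in> {1..Suc i}. wv s2 19 e = r}"
      proof (cases "r = r0")
        case True
        then show ?thesis using es new
          by (intro exI[of _ "Suc i # es"]) (auto simp: s2_def linked_list_upd r0_def le_Suc_eq)
      next
        case False
        then show ?thesis using es new
          by (intro exI[of _ es]) (auto simp: s2_def linked_list_upd r0_def le_Suc_eq)
      qed
    qed
    then have "I (Suc i) t2 s2" if "t2 \<le> t' + 100" for t2
      using *(4) that by (auto simp: I_def s2_def ranked_def items_def cleared_def)
    then show "run s' (WSet 20 succ_i (WArr 21 (WArr 19 succ_i)) ;; WSet 21 (WArr 19 succ_i) succ_i)
        (t' + (wcost (Var 14) + 4))
        (\<lambda>t s. wfs s \<and> wv s 4 0 = i \<and> I (Suc i) (t + 6) (wset 4 0 (Suc i) s))"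
      using * r0 N wfs_wv_less[of s' 21 r0]
      by (simp add: run_simps r0_def[symmetric] s2_def)
  next
    fix t' s' assume "wfs s'" "I N t' s'"
    then show "Q (t' + (wcost (Var 14) + 4)) s'"
      using N by (intro post) (auto simp: I_def L_def linked_def)
  qed (use assms in \<open>auto simp: I_def\<close>)
qed

end

subsection \<open>One pass of the sweep\<close>

definition add_row_prog :: com where
  "add_row_prog =
     VSet 11 (WArr 21 succ_i) ;;
     While (WLess (WLit 0) (Var 11)) (
       RSet 5 (WArr 18 (Var 11)) (RAdd (RArr 5 (WArr 18 (Var 11))) (RArr 4 (Var 11))) ;;
       VSet 11 (WArr 20 (Var 11)))"

text \<open>The walk goes left from the column c' of the row. Once a column is added and the index
  decremented to c, the accumulator is \<open>slab c c'\<close>; the sentinel column 0 is served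
  last. Reading array 6 and writing array 7 keeps the old layer fixed, as in
  \<open>sweep\<close>.\<close>

definition push_row_prog :: com where
  "push_row_prog =
     VSet 13 (WArr 17 succ_i) ;; VSet 12 (Var 13) ;; RSet 0 (WLit 0) (RLit 0) ;;
     While (WLess (WLit 0) (Var 12)) (
       RSet 0 (WLit 0) (RAdd (RArr 0 (WLit 0)) (RArr 5 (Var 12))) ;;
       VSet 12 (WSub (Var 12) (WLit 1)) ;;
       Cond (BAnd (WLess succ_i (WArr 16 (Var 12)))
              (RLess (RArr 7 (Var 12)) (RAdd (RArr 0 (WLit 0)) (RArr 6 (Var 13)))))
         (RSet 7 (Var 12) (RAdd (RArr 0 (WLit 0)) (RArr 6 (Var 13))))
         Skip)"

text \<open>The m + 2 rounds of the second loop include column m + 1, where weights right of all of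
  \<open>Q\<close> may have gathered. Array 7 keeps its contents, because the next sweep starts from
  the layer just completed.\<close>

definition pass_prog :: com where
  "pass_prog =
     For 4 mV (add_row_prog ;; push_row_prog) ;;
     For 4 (WAdd mV (WLit 2)) (RSet 5 (Var 4) (RLit 0) ;; RSet 6 (Var 4) (RArr 7 (Var 4)))"

context ram
begin

text \<open>The time is charged to the items of the row, so that all rows together pay only for the
  number of items.\<close>

lemma run_add_row:
  assumes "wfs s" "wv s 4 0 = i" "i < m" "linked_list (wv s 20) (wv s 21 (Suc i)) es" "distinct es"
    and es: "\<forall>e\<in>set es. e \<le> n \<and> wv s 18 e \<le> Suc m"
    and post: "\<And>t' s'. wfs s' \<Longrightarrow> t' \<le> t + 100 * length es + 50 \<Longrightarrow>
      \<forall>a. a \<noteq> 11 \<longrightarrow> wv s' a = wv s a \<Longrightarrow> \<forall>a. a \<noteq> 5 \<longrightarrow> rv s' a = rv s a \<Longrightarrow>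
      \<forall>c. rv s' 5 c = rv s 5 c + (\<Sum>e | e \<in> set es \<and> wv s 18 e = c. rv s 4 e) \<Longrightarrow> Q t' s'"
  shows "run s add_row_prog t Q"
proof -
  define I where "I = (\<lambda>d t' s'. \<exists>xs ys. es = xs @ ys \<and> length ys = d \<and> wfs s' \<and>
    linked_list (wv s 20) (wv s' 11 0) ys \<and> t' + 100 * d \<le> t + 100 * length es + 20 \<and>
    (\<forall>a. a \<noteq> 11 \<longrightarrow> wv s' a = wv s a) \<and> (\<forall>a. a \<noteq> 5 \<longrightarrow> rv s' a = rv s a) \<and>
    (\<forall>c. rv s' 5 c = rv s 5 c + (\<Sum>e | e \<in> set xs \<and> wv s 18 e = c. rv s 4 e)))"
  let ?b = "WLess (WLit 0) (Var 11)"
  let ?c = "RSet 5 (WArr 18 (Var 11)) (RAdd (RArr 5 (WArr 18 (Var 11))) (RArr 4 (Var 11))) ;;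
       VSet 11 (WArr 20 (Var 11))"
  let ?h = "wv s 21 (Suc i)"
  have h: "?h < W" using wfs_wv_less assms(1) by blast
  have "run (wset 11 0 ?h s) (While ?b ?c) (t + 11) Q"
  proof (rule ok_While[where I = I and n = "length es"])
    show "I (length es) (t + 11) (wset 11 0 ?h s)"
      unfolding I_def
      by (rule exI[of _ "[]"], rule exI[of _ es]) (use assms(1,4) h in simp)
  next
    fix d t' s' assume "I d t' s'"
    then obtain xs ys where I: "es = xs @ ys" "length ys = d" "wfs s'"
      "linked_list (wv s 20) (wv s' 11 0) ys" "t' + 100 * d \<le> t + 100 * length es + 20"
      and wv: "\<And>a. a \<noteq> 11 \<Longrightarrow> wv s' a = wv s a" and rv: "\<And>a. a \<noteq> 5 \<Longrightarrow> rv s' a = rv s a"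
      and sum: "\<And>c. rv s' 5 c = rv s 5 c + (\<Sum>e | e \<in> set xs \<and> wv s 18 e = c. rv s 4 e)"
      by (auto simp: I_def)
    show "blegal S W s' ?b \<and> (if bval s' ?b then 0 < d \<and> run s' ?c (t' + (1 + bcost ?b)) (I (d - 1))
           else Q (t' + (1 + bcost ?b)) s')"
    proof (cases ys)
      case Nil
      have "Q (t' + (1 + bcost ?b)) s'"
        using I wv rv sum Nil by (intro post) auto
      then show ?thesis using I Nil by simp
    next
      case (Cons e ys')
      have e: "wv s' 11 0 = e" "0 < e" "linked_list (wv s 20) (wv s 20 e) ys'" "e \<le> n" "wv s 18 e \<le> Suc m"
        using I(1,4) es Cons by auto
      let ?c1 = "wv s 18 e" and ?n1 = "wv s 20 e"
      define s2 where "s2 = wset 11 0 ?n1 (rset 5 ?c1 (rv s' 5 ?c1 + rv s 4 e) s')"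
      have n1: "?n1 < W" using wfs_wv_less assms(1) by blast
      have "e \<notin> set xs" using assms(5) I(1) Cons by auto
      then have "{e'. e' \<in> set (xs @ [e]) \<and> wv s 18 e' = c} =
        (if ?c1 = c then insert e {e'. e' \<in> set xs \<and> wv s 18 e' = c} else {e'. e' \<in> set xs \<and> wv s 18 e' = c})" for c
        by auto
      then have "(\<Sum>e' | e' \<in> set (xs @ [e]) \<and> wv s 18 e' = c. rv s 4 e') =
        (\<Sum>e' | e' \<in> set xs \<and> wv s 18 e' = c. rv s 4 e') + (if ?c1 = c then rv s 4 e else 0)" for c
        using \<open>e \<notin> set xs\<close> by simp
      note new = this
      have "I (d - 1) t2 s2" if "t2 \<le> t' + 100" for t2
        unfolding I_def
      proof (intro exI conjI)
        show "es = (xs @ [e]) @ ys'" using I Cons by simp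
        show "\<forall>c. rv s2 5 c = rv s 5 c + (\<Sum>e' | e' \<in> set (xs @ [e]) \<and> wv s 18 e' = c. rv s 4 e')"
          unfolding new using sum by (simp add: s2_def)
      qed (use that I Cons e n1 wv rv in \<open>auto simp: s2_def\<close>)
      then show ?thesis
        using I(3) e n1 wv rv Cons I(2) by (simp add: run_simps s2_def)
    qed
  qed
  then show ?thesis
    using assms(1-3) h S SW by (simp add: add_row_prog_def run_simps eval_nat_numeral)
qed

lemma run_push_row:
  assumes "wfs s" "wv s 4 0 = i" "i < m" "wv s 17 (Suc i) = c'" "c' \<le> m"
    and post: "\<And>t' s'. wfs s' \<Longrightarrow> t' \<le> t + 200 * m + 200 \<Longrightarrow>
      \<forall>a. a \<noteq> 12 \<and> a \<noteq> 13 \<longrightarrow> wv s' a = wv s a \<Longrightarrow> \<forall>a. a \<noteq> 0 \<and> a \<noteq> 7 \<longrightarrow> rv s' a = rv s a \<Longrightarrow>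
      \<forall>c. rv s' 7 c = (if c < c' \<and> Suc i < wv s 16 c
         then max (rv s 7 c) ((\<Sum>x\<in>{c<..c'}. rv s 5 x) + rv s 6 c') else rv s 7 c) \<Longrightarrow> Q t' s'"
  shows "run s push_row_prog t Q"
proof -
  define val where "val = (\<lambda>c. (\<Sum>x\<in>{c<..c'}. rv s 5 x) + rv s 6 c')"
  \<comment> \<open>\<open>d\<close> is the column last served: the columns from \<open>d\<close> to
    \<open>c' - 1\<close> have received their candidate, and the accumulator covers the columns
    right of \<open>d\<close> up to \<open>c'\<close>.\<close>
  define I where "I = (\<lambda>d t' s'. wfs s' \<and> d \<le> c' \<and> wv s' 12 0 = d \<and> wv s' 13 0 = c' \<and>
    t' + 200 * d \<le> t + 200 * c' + 50 \<and>
    (\<forall>a. a \<noteq> 12 \<and> a \<noteq> 13 \<longrightarrow> wv s' a = wv s a) \<and> (\<forall>a. a \<noteq> 0 \<and> a \<noteq> 7 \<longrightarrow> rv s' a = rv s a) \<and>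
    rv s' 0 0 = (\<Sum>x\<in>{d<..c'}. rv s 5 x) \<and>
    (\<forall>c. rv s' 7 c = (if d \<le> c \<and> c < c' \<and> Suc i < wv s 16 c then max (rv s 7 c) (val c) else rv s 7 c)))"
  let ?b = "WLess (WLit 0) (Var 12)"
  let ?c = "RSet 0 (WLit 0) (RAdd (RArr 0 (WLit 0)) (RArr 5 (Var 12))) ;;
       VSet 12 (WSub (Var 12) (WLit 1)) ;;
       Cond (BAnd (WLess succ_i (WArr 16 (Var 12)))
              (RLess (RArr 7 (Var 12)) (RAdd (RArr 0 (WLit 0)) (RArr 6 (Var 13)))))
         (RSet 7 (Var 12) (RAdd (RArr 0 (WLit 0)) (RArr 6 (Var 13))))
         Skip"
  have cW: "c' < W" "c' \<le> n + m + 1" using assms(5) m_less_W by auto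
  have iW: "Suc i < W" using assms(3) m_less_W by auto
  define s0 where "s0 = rset 0 0 0 (wset 12 0 c' (wset 13 0 c' s))"
  have "run s0 (While ?b ?c) (t + 28) Q"
  proof (rule ok_While[where I = I and n = c'])
    show "I c' (t + 28) s0"
      using assms(1) cW by (auto simp: I_def s0_def)
  next
    fix d t' s' assume "I d t' s'"
    then have I: "wfs s'" "d \<le> c'" "wv s' 12 0 = d" "wv s' 13 0 = c'" "t' + 200 * d \<le> t + 200 * c' + 50"
      and wv: "\<And>a. a \<noteq> 12 \<and> a \<noteq> 13 \<Longrightarrow> wv s' a = wv s a"
      and rv: "\<And>a. a \<noteq> 0 \<and> a \<noteq> 7 \<Longrightarrow> rv s' a = rv s a"
      and acc: "rv s' 0 0 = (\<Sum>x\<in>{d<..c'}. rv s 5 x)"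
      and res: "\<And>c. rv s' 7 c = (if d \<le> c \<and> c < c' \<and> Suc i < wv s 16 c then max (rv s 7 c) (val c) else rv s 7 c)"
      by (auto simp: I_def)
    show "blegal S W s' ?b \<and> (if bval s' ?b then 0 < d \<and> run s' ?c (t' + (1 + bcost ?b)) (I (d - 1))
           else Q (t' + (1 + bcost ?b)) s')"
    proof (cases d)
      case 0
      have "Q (t' + (1 + bcost ?b)) s'"
      proof (rule post)
        show "\<forall>c. rv s' 7 c = (if c < c' \<and> Suc i < wv s 16 c
         then max (rv s 7 c) ((\<Sum>x\<in>{c<..c'}. rv s 5 x) + rv s 6 c') else rv s 7 c)"
          using res 0 by (auto simp: val_def)
      qed (use I wv rv 0 assms(5) in auto)
      then show ?thesis using I 0 by simp
    next
      case (Suc e)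
      have "{e<..c'} = insert (Suc e) {Suc e<..c'}" using I(2) Suc by auto
      then have acc': "rv s' 0 0 + rv s 5 (Suc e) = (\<Sum>x\<in>{e<..c'}. rv s 5 x)"
        using acc Suc by simp
      define v where "v = (\<Sum>x\<in>{e<..c'}. rv s 5 x)"
      have v: "v + rv s 6 c' = val e" by (simp add: v_def val_def)
      have res_e: "rv s' 7 e = rv s 7 e" using res Suc by simp
      define s2 where "s2 = wset 12 0 e (rset 0 0 v s')"
      have e: "e < c'" "e < W" "e \<le> n + m + 1" using I(2) Suc cW by auto
      have le: "e \<le> c \<longleftrightarrow> c = e \<or> Suc e \<le> c" for c by auto
      \<comment> \<open>Storing only after a strict comparison computes the maximum, so both
        branches restore the invariant.\<close>
      have skip: "I e t2 s2" if "t2 \<le> t' + 200" "\<not> (Suc i < wv s 16 e \<and> rv s 7 e < val e)" for t2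
        using that I wv rv res e unfolding I_def s2_def
        by (auto simp: Suc v_def le max_def)
      have upd: "I e t2 (rset 7 e (val e) s2)"
        if "t2 \<le> t' + 200" "Suc i < wv s 16 e" "rv s 7 e < val e" for t2
        using that I wv rv res e unfolding I_def s2_def
        by (auto simp: Suc v_def le max_def)
      have "run s' ?c (t' + (1 + bcost ?b)) (I e)"
        using I(1,3,4) wv rv e cW iW skip upd res_e v acc' assms(2) Suc
        by (auto simp: run_simps v_def[symmetric] s2_def)
      then show ?thesis using I Suc by simp
    qed
  qed
  then show ?thesis
    using assms(1-4) cW iW S SW by (simp add: push_row_prog_def run_simps s0_def eval_nat_numeral)
qed


section \<open>From columns of the rank grid back to subsets of \<open>Q\<close>\<close>

definition row_of :: "nat \<Rightarrow> nat" where
  "row_of c = (if c = 0 then Suc m else ry (inv_into {..<m} rx c))"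
definition col_of :: "nat \<Rightarrow> nat" where "col_of r = rx (inv_into {..<m} ry r)"

lemma rx_onto: "1 \<le> c \<Longrightarrow> c \<le> m \<Longrightarrow> \<exists>i<m. rx i = c"
  using rank_onto[of c m "\<lambda>i. xq i"] by (simp add: rx_def)

lemma ry_onto: "1 \<le> c \<Longrightarrow> c \<le> m \<Longrightarrow> \<exists>i<m. ry i = c"
  using rank_onto[of c m "\<lambda>i. yq i"] by (simp add: ry_def)

lemma inj_rx: "inj_on rx {..<m}" by (simp add: inj_on_def rx_eq)
lemma inj_ry: "inj_on ry {..<m}" by (simp add: inj_on_def ry_eq)

lemma row_of_rx: "i < m \<Longrightarrow> row_of (rx i) = ry i"
  using inv_into_f_f[OF inj_rx, of i] by (simp add: row_of_def)

lemma col_of_ry: "i < m \<Longrightarrow> col_of (ry i) = rx i"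
  using inv_into_f_f[OF inj_ry, of i] by (simp add: col_of_def)

sublocale st: staircase n m cx cy "\<lambda>p. wp p" row_of col_of
proof
  fix r assume "1 \<le> r" "r \<le> m"
  then obtain i where "i < m" "ry i = r" using ry_onto by blast
  then show "1 \<le> col_of r \<and> col_of r \<le> m \<and> row_of (col_of r) = r"
    using col_of_ry[of i] row_of_rx[of i] rx_range[of i] by auto
next
  fix c assume "1 \<le> c" "c \<le> m"
  then obtain i where "i < m" "rx i = c" using rx_onto by blast
  then show "1 \<le> row_of c \<and> row_of c \<le> m \<and> col_of (row_of c) = c"
    using col_of_ry[of i] row_of_rx[of i] ry_range[of i] by auto
next
  show "m < row_of 0" by (simp add: row_of_def)
  show "0 < cx p" for p using cx_range(1)[of p] by simp
qed

lemma ranked_RKf: "ranked s \<Longrightarrow> c \<le> m \<Longrightarrow> wv s 16 c = row_of c"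
proof (cases "c = 0")
  case True
  assume "ranked s" then show ?thesis using True by (simp add: ranked_def row_of_def)
next
  case False
  assume "ranked s" "c \<le> m"
  then obtain i where "i < m" "rx i = c" using rx_onto[of c] False by auto
  then show ?thesis using row_of_rx[of i] \<open>ranked s\<close> by (auto simp: ranked_def)
qed

lemma ranked_CKf: "ranked s \<Longrightarrow> 1 \<le> r \<Longrightarrow> r \<le> m \<Longrightarrow> wv s 17 r = col_of r"
proof -
  assume "ranked s" "1 \<le> r" "r \<le> m"
  then obtain i where "i < m" "ry i = r" using ry_onto[of r] by auto
  then show ?thesis using col_of_ry[of i] \<open>ranked s\<close> by (auto simp: ranked_def)
qed

text \<open>Applying \<open>position_le_rank\<close> on both axes turns dominance by a point of
  \<open>Q\<close> into a comparison of grid coordinates, and each column of \<open>C\<close> is the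
  x-rank of an index. \<open>distinct ps\<close> lets the sum over indices count every point
  once.\<close>

lemma covered_region:
  assumes "distinct ps" "C \<subseteq> {1..m}"
  shows "st.covered C = region_weight (set ps) w (dom_set ((!) qs ` {i. i < m \<and> rx i \<in> C}))"
proof -
  let ?R = "dom_set ((!) qs ` {i. i < m \<and> rx i \<in> C})"
  have mem: "ps ! p \<in> ?R \<longleftrightarrow> (\<exists>x\<in>C. cx p \<le> x \<and> cy p \<le> row_of x)" for p
  proof -
    have "ps ! p \<in> ?R \<longleftrightarrow> (\<exists>i<m. rx i \<in> C \<and> xp p \<le> xq i \<and> yp p \<le> yq i)"
      by (auto simp: dom_set_def dom_point_def mem_Times_iff)
    also have "\<dots> \<longleftrightarrow> (\<exists>i<m. rx i \<in> C \<and> cx p \<le> rx i \<and> cy p \<le> ry i)"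
      by (metis (no_types, lifting) position_le_rank cx_def cy_def rx_def ry_def)
    also have "\<dots> \<longleftrightarrow> (\<exists>x\<in>C. cx p \<le> x \<and> cy p \<le> row_of x)"
    proof
      assume "\<exists>x\<in>C. cx p \<le> x \<and> cy p \<le> row_of x"
      then obtain x where x: "x \<in> C" "cx p \<le> x" "cy p \<le> row_of x" by blast
      then obtain i where "i < m" "rx i = x" using rx_onto[of x] subsetD[OF assms(2), of x] by auto
      then show "\<exists>i<m. rx i \<in> C \<and> cx p \<le> rx i \<and> cy p \<le> ry i" using x row_of_rx[of i] by auto
    qed (use row_of_rx in auto)
    finally show ?thesis .
  qed
  have "set ps \<inter> ?R = (!) ps ` {p. p < n \<and> ps ! p \<in> ?R}"
  proof (intro equalityI subsetI)
    fix q assume "q \<in> set ps \<inter> ?R"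
    then obtain p where "p < n" "q = ps ! p" "q \<in> ?R" by (metis Int_iff in_set_conv_nth n_def)
    then show "q \<in> (!) ps ` {p. p < n \<and> ps ! p \<in> ?R}" by blast
  qed (auto simp: n_def)
  moreover have "inj_on ((!) ps) {p. p < n \<and> ps ! p \<in> ?R}"
    using assms(1) by (auto simp: inj_on_def nth_eq_iff_index_eq n_def)
  ultimately have "region_weight (set ps) w ?R = (\<Sum>p | p < n \<and> ps ! p \<in> ?R. wp p)"
    by (simp add: region_weight_def sum.reindex)
  then show ?thesis unfolding st.covered_def mem by simp
qed

text \<open>Subsets of \<open>Q\<close> and sets of columns are translated into each other through
  indices; x-ranks are injective on indices, so the cardinality bound carries over in both
  directions.\<close>

lemma maxDominance_best:
  assumes "distinct ps" "distinct qs"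
  shows "maxDominance (set ps) w (set qs) k = st.best k 0"
  unfolding maxDominance_def
proof (rule Max_eqI)
  have "{region_weight (set ps) w (dom_set Q') |Q'. Q' \<subseteq> set qs \<and> card Q' \<le> k} \<subseteq>
    (\<lambda>Q'. region_weight (set ps) w (dom_set Q')) ` Pow (set qs)" by auto
  then show "finite {region_weight (set ps) w (dom_set Q') |Q'. Q' \<subseteq> set qs \<and> card Q' \<le> k}"
    by (rule finite_subset) simp
next
  have inj_qs: "inj_on ((!) qs) {..<m}"
    using assms(2) by (auto simp: inj_on_def nth_eq_iff_index_eq m_def)
  fix y assume "y \<in> {region_weight (set ps) w (dom_set Q') |Q'. Q' \<subseteq> set qs \<and> card Q' \<le> k}"
  then obtain Q' where Q': "Q' \<subseteq> set qs" "card Q' \<le> k" "y = region_weight (set ps) w (dom_set Q')"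
    by auto
  define J where "J = {i. i < m \<and> qs ! i \<in> Q'}"
  have J: "J \<subseteq> {..<m}" by (auto simp: J_def)
  have Q'_J: "Q' = (!) qs ` J"
  proof (intro equalityI subsetI)
    fix q assume "q \<in> Q'"
    moreover then obtain i where "i < m" "q = qs ! i"
      using Q'(1) by (metis in_set_conv_nth m_def subsetD)
    ultimately show "q \<in> (!) qs ` J" by (auto simp: J_def)
  qed (auto simp: J_def)
  have "card (rx ` J) = card J" using inj_on_subset[OF inj_rx J] by (rule card_image)
  also have "\<dots> = card Q'" unfolding Q'_J using inj_on_subset[OF inj_qs J] by (simp add: card_image)
  finally have "card (rx ` J) \<le> k" using Q'(2) by simp
  moreover have C: "rx ` J \<subseteq> {1..m}" using rx_range by (fastforce simp: J_def)
  ultimately have "st.covered (rx ` J) \<le> st.best k 0" by (intro st.best_covered_upper)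
  moreover have "{i. i < m \<and> rx i \<in> rx ` J} = J" using rx_eq by (auto simp: J_def)
  ultimately show "y \<le> st.best k 0"
    using covered_region[OF assms(1) C] Q'(3) Q'_J by simp
next
  obtain C where C: "C \<subseteq> {1..m}" "card C \<le> k" "st.covered C = st.best k 0"
    using st.best_covered_attained by blast
  define J where "J = {i. i < m \<and> rx i \<in> C}"
  have fin: "finite C" using C(1) finite_subset by blast
  have "card ((!) qs ` J) \<le> card J" by (rule card_image_le) (simp add: J_def)
  also have "\<dots> = card (rx ` J)" using inj_on_subset[OF inj_rx, of J] by (intro card_image[symmetric]) (auto simp: J_def)
  also have "\<dots> \<le> card C" using fin by (intro card_mono) (auto simp: J_def)
  finally have "card ((!) qs ` J) \<le> k" using C(2) by simp
  moreover have "(!) qs ` J \<subseteq> set qs" by (auto simp: J_def m_def)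
  ultimately show "st.best k 0 \<in> {region_weight (set ps) w (dom_set Q') |Q'. Q' \<subseteq> set qs \<and> card Q' \<le> k}"
    using covered_region[OF assms(1) C(1)] C(3) unfolding J_def[symmetric]
    by (intro CollectI exI[of _ "(!) qs ` J"] conjI) simp_all
qed

definition prepared :: "state \<Rightarrow> bool" where
  "prepared s \<longleftrightarrow> ranked s \<and> items s \<and> linked s"

text \<open>Word arrays 4 to 13 are scratch and 15 counts passes; real arrays 0 and 5 to 7 change
  during a pass. What the preprocessing built lies in the others.\<close>

lemma prepared_cong:
  assumes "\<And>a. 14 \<le> a \<Longrightarrow> a \<noteq> 15 \<Longrightarrow> wv s' a = wv s a" "\<And>a. 2 \<le> a \<Longrightarrow> a \<le> 4 \<Longrightarrow> rv s' a = rv s a"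
  shows "prepared s' \<longleftrightarrow> prepared s"
  using assms by (simp add: prepared_def ranked_def items_def linked_def)

lemma colw_Suc:
  "st.colw (Suc i) c = st.colw i c + (\<Sum>p | p < n \<and> cx p = c \<and> cy p = Suc i. wp p)"
proof -
  have "{p. p < n \<and> cx p = c \<and> cy p \<le> Suc i} =
    {p. p < n \<and> cx p = c \<and> cy p \<le> i} \<union> {p. p < n \<and> cx p = c \<and> cy p = Suc i}" by auto
  moreover have "sum (\<lambda>p. wp p) ({p. p < n \<and> cx p = c \<and> cy p \<le> i} \<union> {p. p < n \<and> cx p = c \<and> cy p = Suc i}) =
    sum (\<lambda>p. wp p) {p. p < n \<and> cx p = c \<and> cy p \<le> i} + sum (\<lambda>p. wp p) {p. p < n \<and> cx p = c \<and> cy p = Suc i}"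
    by (rule sum.union_disjoint) auto
  ultimately show ?thesis unfolding st.colw_def by simp
qed

lemma colw_0: "st.colw 0 c = 0"
proof -
  have "\<not> cy p \<le> 0" for p using cy_range(1)[of p] by simp
  then have "{p. p < n \<and> cx p = c \<and> cy p \<le> 0} = {}" by blast
  then show ?thesis unfolding st.colw_def by (metis sum.empty)
qed

definition pass_inv :: "nat \<Rightarrow> state \<Rightarrow> bool" where
  "pass_inv j s \<longleftrightarrow> prepared s \<and> (\<forall>c\<le>m. rv s 5 c = 0 \<and> rv s 6 c = st.best j c \<and> rv s 7 c = st.best j c)"

lemma run_pass:
  assumes "wfs s" "pass_inv j s" "0 < m"
    and post: "\<And>t' s'. wfs s' \<Longrightarrow> t' \<le> t + 2000 * (m * m) \<Longrightarrow> pass_inv (Suc j) s' \<Longrightarrow>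
      wv s' 15 = wv s 15 \<Longrightarrow> Q t' s'"
  shows "run s pass_prog t Q"
proof -
  define N where "N = wv s 14 0"
  \<comment> \<open>\<open>cnt i\<close> pays for the list walks through row \<open>i\<close>. A
    single row may hold many items, but in total they number at most
    \<open>N <= m * m\<close>.\<close>
  define cnt where "cnt = (\<lambda>i. card {e \<in> {1..N}. wv s 19 e \<le> i})"
  have prep: "ranked s" "items s" "linked s" using assms(2) by (auto simp: pass_inv_def prepared_def)
  have N: "N \<le> m * m" "N \<le> n" using prep(2) by (auto simp: items_def N_def)
  define I where "I = (\<lambda>i t' s'. t' \<le> t + i * (200 * m + 300) + 100 * cnt i + 3 \<and>
    (\<forall>a. a \<noteq> 4 \<and> a \<noteq> 11 \<and> a \<noteq> 12 \<and> a \<noteq> 13 \<longrightarrow> wv s' a = wv s a) \<and>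
    (\<forall>a. a \<noteq> 0 \<and> a \<noteq> 5 \<and> a \<noteq> 7 \<longrightarrow> rv s' a = rv s a) \<and>
    (\<forall>c. 1 \<le> c \<and> c \<le> m \<longrightarrow> rv s' 5 c = st.colw i c) \<and>
    (\<forall>c\<le>m. rv s' 7 c = st.sweep (st.best j) i c))"
  define R where "R = (\<lambda>i t' s'. t' \<le> t + m * (200 * m + 300) + 100 * (m * m) + 100 + 100 * i \<and>
    (\<forall>a. a \<noteq> 4 \<and> a \<noteq> 11 \<and> a \<noteq> 12 \<and> a \<noteq> 13 \<longrightarrow> wv s' a = wv s a) \<and>
    (\<forall>a. a \<noteq> 0 \<and> a \<noteq> 5 \<and> a \<noteq> 6 \<and> a \<noteq> 7 \<longrightarrow> rv s' a = rv s a) \<and>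
    (\<forall>c\<le>m. rv s' 7 c = st.best (Suc j) c) \<and>
    (\<forall>c. c < i \<and> c \<le> m \<longrightarrow> rv s' 5 c = 0 \<and> rv s' 6 c = st.best (Suc j) c))"
  show ?thesis
    unfolding pass_prog_def run_Seq[of _ "For 4 mV _"]
  proof (rule run_For[where N = m and I = I])
    show "I 0 (t + 3) (wset 4 0 0 s)"
      using assms by (auto simp: I_def pass_inv_def colw_0)
  next
    fix i t' s'
    assume *: "wfs s'" "i < m" "Suc i < W" "I i t' s'" "wv s' 4 0 = i"
    have I: "t' \<le> t + i * (200 * m + 300) + 100 * cnt i + 3"
      "\<And>a. a \<noteq> 4 \<and> a \<noteq> 11 \<and> a \<noteq> 12 \<and> a \<noteq> 13 \<Longrightarrow> wv s' a = wv s a"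
      "\<And>a. a \<noteq> 0 \<and> a \<noteq> 5 \<and> a \<noteq> 7 \<Longrightarrow> rv s' a = rv s a"
      "\<And>c. 1 \<le> c \<Longrightarrow> c \<le> m \<Longrightarrow> rv s' 5 c = st.colw i c"
      "\<And>c. c \<le> m \<Longrightarrow> rv s' 7 c = st.sweep (st.best j) i c"
      using *(4) by (auto simp: I_def)
    obtain es where es: "linked_list (wv s 20) (wv s 21 (Suc i)) es" "distinct es"
      "set es = {e \<in> {1..N}. wv s 19 e = Suc i}"
      using prep(3)[unfolded linked_def, rule_format, of "Suc i"] *(2) by (auto simp: N_def)
    have cnt: "cnt (Suc i) = cnt i + length es"
    proof -
      have "{e \<in> {1..N}. wv s 19 e \<le> Suc i} = {e \<in> {1..N}. wv s 19 e \<le> i} \<union> set es"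
        unfolding es(3) by (auto simp: le_Suc_eq)
      moreover have "card ({e \<in> {1..N}. wv s 19 e \<le> i} \<union> set es) = card {e \<in> {1..N}. wv s 19 e \<le> i} + card (set es)"
        unfolding es(3) by (rule card_Un_disjoint) auto
      ultimately show ?thesis using distinct_card[OF es(2)] by (simp add: cnt_def)
    qed
    \<comment> \<open>Items enter only through cell totals, which \<open>items\<close> equates with
      sums over the original points.\<close>
    have row: "(\<Sum>e | e \<in> set es \<and> wv s 18 e = c. rv s 4 e) = (\<Sum>p | p < n \<and> cx p = c \<and> cy p = Suc i. wp p)"
      if "1 \<le> c" "c \<le> m" for c
    proof -
      have "{e. e \<in> set es \<and> wv s 18 e = c} = {e. e \<in> {1..N} \<and> wv s 18 e = c \<and> wv s 19 e = Suc i}"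
        using es(3) by auto
      then show ?thesis using prep(2) that *(2) by (auto simp: items_def N_def)
    qed
    define c' where "c' = col_of (Suc i)"
    have c': "1 \<le> c'" "c' \<le> m" "row_of c' = Suc i" "wv s 17 (Suc i) = c'"
      using st.CK[of "Suc i"] ranked_CKf[OF prep(1), of "Suc i"] *(2) by (auto simp: c'_def)
    show "run s' (add_row_prog ;; push_row_prog) (t' + (wcost mV + 4))
          (\<lambda>t s. wfs s \<and> wv s 4 0 = i \<and> I (Suc i) (t + 6) (wset 4 0 (Suc i) s))"
      unfolding run_Seq
    proof (rule run_add_row[where i = i and es = es])
      show "linked_list (wv s' 20) (wv s' 21 (Suc i)) es" using es(1) I(2) by simp
      show "\<forall>e\<in>set es. e \<le> n \<and> wv s' 18 e \<le> Suc m"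
        using es(3) I(2) prep(2) N by (auto simp: items_def N_def)
    next
      fix t1 s1
      assume 1: "wfs s1" "t1 \<le> t' + (wcost mV + 4) + 100 * length es + 50"
        "\<forall>a. a \<noteq> 11 \<longrightarrow> wv s1 a = wv s' a" "\<forall>a. a \<noteq> 5 \<longrightarrow> rv s1 a = rv s' a"
        "\<forall>c. rv s1 5 c = rv s' 5 c + (\<Sum>e | e \<in> set es \<and> wv s' 18 e = c. rv s' 4 e)"
      have col: "rv s1 5 c = st.colw (Suc i) c" if "1 \<le> c" "c \<le> m" for c
        using 1(5) row[OF that] I(2)[of 18] I(3)[of 4] I(4)[OF that] by (simp add: colw_Suc)
      show "run s1 push_row_prog t1
          (\<lambda>t s. wfs s \<and> wv s 4 0 = i \<and> I (Suc i) (t + 6) (wset 4 0 (Suc i) s))"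
      proof (rule run_push_row[where i = i and c' = c'])
        show "wv s1 17 (Suc i) = c'" using 1(3) I(2) c' by simp
      next
        fix t2 s2
        assume 2: "wfs s2" "t2 \<le> t1 + 200 * m + 200"
          "\<forall>a. a \<noteq> 12 \<and> a \<noteq> 13 \<longrightarrow> wv s2 a = wv s1 a" "\<forall>a. a \<noteq> 0 \<and> a \<noteq> 7 \<longrightarrow> rv s2 a = rv s1 a"
          "\<forall>c. rv s2 7 c = (if c < c' \<and> Suc i < wv s1 16 c
           then max (rv s1 7 c) ((\<Sum>x\<in>{c<..c'}. rv s1 5 x) + rv s1 6 c') else rv s1 7 c)"
        have "rv s2 7 c = st.sweep (st.best j) (Suc i) c" if "c \<le> m" for c
        proof -
          have "(\<Sum>x\<in>{c<..c'}. rv s1 5 x) = st.slab c c'"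
            unfolding st.slab_def c'(3) using c'(2) by (intro sum.cong col) auto
          moreover have "rv s1 6 c' = st.best j c'"
            using 1(4) I(3) assms(2) c'(2) by (simp add: pass_inv_def)
          moreover have "wv s1 16 c = row_of c"
            using 1(3) I(2) ranked_RKf[OF prep(1) that] by simp
          moreover have "rv s1 7 c = st.sweep (st.best j) i c" using 1(4) I(5)[OF that] by simp
          ultimately show ?thesis using 2(5) by (simp add: c'_def)
        qed
        then show "wfs s2 \<and> wv s2 4 0 = i \<and> I (Suc i) (t2 + 6) (wset 4 0 (Suc i) s2)"
          using 2(1-4) 1(2-4) I(1-3) cnt col *(2,3,5) by (auto simp: I_def)
      qed (use 1 * c' in auto)
    qed (use * es in auto)
  next
    fix t0 s0 assume 0: "wfs s0" "I m t0 s0"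
    have "{e \<in> {1..N}. wv s 19 e \<le> m} \<subseteq> {1..N}" by blast
    from card_mono[OF _ this] have "cnt m \<le> N" by (simp add: cnt_def)
    then have cnt: "cnt m \<le> m * m" using N by simp
    show "run s0 (For 4 (WAdd mV (WLit 2)) (RSet 5 (Var 4) (RLit 0) ;; RSet 6 (Var 4) (RArr 7 (Var 4))))
          (t0 + (wcost mV + 4)) Q"
    proof (rule run_For[where N = "m + 2" and I = R])
      show "R 0 (t0 + (wcost mV + 4) + 3) (wset 4 0 0 s0)"
        using 0 cnt by (auto simp: R_def I_def)
    next
      fix i t' s'
      assume *: "wfs s'" "i < m + 2" "Suc i < W" "R i t' s'" "wv s' 4 0 = i"
      then show "run s' (RSet 5 (Var 4) (RLit 0) ;; RSet 6 (Var 4) (RArr 7 (Var 4)))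
          (t' + (wcost (WAdd mV (WLit 2)) + 4))
          (\<lambda>t s. wfs s \<and> wv s 4 0 = i \<and> R (Suc i) (t + 6) (wset 4 0 (Suc i) s))"
        by (auto simp: run_simps R_def less_Suc_eq)
    next
      fix t' s' assume *: "wfs s'" "R (m + 2) t' s'"
      have "prepared s' \<longleftrightarrow> prepared s" using *(2) by (intro prepared_cong) (auto simp: R_def)
      moreover have "t' + 8 \<le> t + 2000 * (m * m)"
      proof -
        define q where "q = m * m"
        \<comment> \<open>\<open>0 < m\<close> turns the linear terms and the constants into
          multiples of \<open>m * m\<close>.\<close>
        have q: "m \<le> q" "1 \<le> q" using assms(3) by (auto simp: q_def)
        have "m * (200 * m + 300) = 200 * q + 300 * m" by (simp add: q_def algebra_simps)
        then have "t' \<le> t + (200 * q + 300 * m) + 100 * q + 100 + 100 * (m + 2)"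
          using *(2) by (simp add: R_def q_def)
        then show ?thesis using q by (simp flip: q_def)
      qed
      ultimately show "Q (t' + (wcost (WAdd mV (WLit 2)) + 4)) s'"
        using * assms(2) by (intro post) (auto simp: R_def pass_inv_def)
    qed (use 0 m_less_W S SW in \<open>auto simp: R_def\<close>)
  qed (use assms in auto)
qed

end

subsection \<open>The whole program\<close>

text \<open>For m = 0 only the empty selection exists. This case is split off since even an idle
  loop over \<open>k\<close> would exceed the time bound, which then contains no \<open>k\<close>.
  The result goes to real cell 0, which belongs to the input, and is therefore stored last.\<close>

definition solve_prog :: com where
  "solve_prog =
     Cond (WLess (WLit 0) mV)
       (rank_prog ;; items_prog ;; clear_prog ;; link_prog ;; For 15 kV pass_prog ;;
        RStore (WLit 0) (RArr 6 (WLit 0)))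
       (RStore (WLit 0) (RLit 0))"

context ram
begin

lemma wfs_input_state: "wfs (input_state ps w qs k)"
proof -
  have "n < W" using S SW by simp
  then have "mem_of [n, m, k] x < W" for x
    using m_less_W kW by (auto simp: mem_of_def less_Suc_eq numeral_3_eq_3)
  then show ?thesis by (simp add: wfs_def input_state_def mem_of_def n_def m_def)
qed

lemma run_solve:
  assumes "distinct ps" "distinct qs" "m < 2 ^ D"
  shows "run (input_state ps w qs k) solve_prog 0 (\<lambda>t s. result s = maxDominance (set ps) w (set qs) k \<and>
     (if m = 0 then t \<le> 100
      else t \<le> m * (200 * m + 200) + n * (200 * D + 700) + 100 * m + k * (2000 * (m * m) + 20) + 1000))"
    (is "run ?s _ _ ?Q")
proof (cases "m = 0")
  case True
  \<comment> \<open>Without columns the empty chain is the only one.\<close>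
  then have "st.best k 0 = 0"
    using st.best_attained[of 0 k] by (metis st.chain.elims(2) st.val.simps(1) le_zero_eq not_less_zero)
  then have "maxDominance (set ps) w (set qs) k = 0" using maxDominance_best assms by simp
  moreover have "0 < S" by (simp add: small)
  ultimately show ?thesis
    using wfs_input_state True by (simp add: solve_prog_def run_simps ok_RStore result_def)
next
  case False
  have "run ?s rank_prog 5 (\<lambda>t s. run s items_prog t (\<lambda>t s. run s clear_prog t
      (\<lambda>t s. run s link_prog t (\<lambda>t s. run s (For 15 kV pass_prog) t
      (\<lambda>t s. run s (RStore (WLit 0) (RArr 6 (WLit 0))) t ?Q)))))"
  proof (rule run_rank[OF wfs_input_state])
    fix t1 s1 assume 1: "wfs s1" "t1 \<le> 5 + m * (200 * m + 200) + 100" "ranked s1"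
    show "run s1 items_prog t1 (\<lambda>t s. run s clear_prog t
      (\<lambda>t s. run s link_prog t (\<lambda>t s. run s (For 15 kV pass_prog) t
      (\<lambda>t s. run s (RStore (WLit 0) (RArr 6 (WLit 0))) t ?Q))))"
    proof (rule run_items[OF 1(1,3) assms(3)])
      fix t2 s2 assume 2: "wfs s2" "t2 \<le> t1 + n * (200 * D + 600) + 200" "ranked s2" "items s2"
      show "run s2 clear_prog t2
        (\<lambda>t s. run s link_prog t (\<lambda>t s. run s (For 15 kV pass_prog) t
        (\<lambda>t s. run s (RStore (WLit 0) (RArr 6 (WLit 0))) t ?Q)))"
      proof (rule run_clear[OF 2(1,3,4)])
        fix t3 s3 assume 3: "wfs s3" "t3 \<le> t2 + 100 * m + 300" "ranked s3" "items s3" "cleared s3"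
          "\<forall>r\<le>Suc m. wv s3 21 r = 0"
        show "run s3 link_prog t3 (\<lambda>t s. run s (For 15 kV pass_prog) t
          (\<lambda>t s. run s (RStore (WLit 0) (RArr 6 (WLit 0))) t ?Q))"
        proof (rule run_link[OF 3(1,3-6)])
          fix t4 s4 assume 4: "wfs s4" "t4 \<le> t3 + 100 * n + 100" "ranked s4" "items s4" "cleared s4" "linked s4"
          have T: "t4 \<le> m * (200 * m + 200) + n * (200 * D + 700) + 100 * m + 900"
            using 1(2) 2(2) 3(2) 4(2) by (simp add: algebra_simps)
          have inv_wset: "pass_inv j (wset 15 0 x s) \<longleftrightarrow> pass_inv j s" for j x s
          proof -
            have "prepared (wset 15 0 x s) \<longleftrightarrow> prepared s" by (rule prepared_cong) auto
            then show ?thesis by (simp add: pass_inv_def)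
          qed
          have "pass_inv 0 s4" using 4 by (simp add: pass_inv_def prepared_def cleared_def)
          show "run s4 (For 15 kV pass_prog) t4
            (\<lambda>t s. run s (RStore (WLit 0) (RArr 6 (WLit 0))) t ?Q)"
          proof (rule run_For[where N = k and I = "\<lambda>j t s. t \<le> t4 + j * (2000 * (m * m) + 20) + 3 \<and> pass_inv j s"])
            fix j t s
            assume *: "wfs s" "j < k" "t \<le> t4 + j * (2000 * (m * m) + 20) + 3 \<and> pass_inv j s" "wv s 15 0 = j"
            show "run s pass_prog (t + (wcost kV + 4)) (\<lambda>t s. wfs s \<and> wv s 15 0 = j \<and>
              t + 6 \<le> t4 + Suc j * (2000 * (m * m) + 20) + 3 \<and> pass_inv (Suc j) (wset 15 0 (Suc j) s))"
              using * False by (intro run_pass[OF *(1), of j]) (auto simp: inv_wset)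
          next
            fix t s
            assume *: "wfs s" "t \<le> t4 + k * (2000 * (m * m) + 20) + 3 \<and> pass_inv k s"
            have "rv s 6 0 = maxDominance (set ps) w (set qs) k"
              using * maxDominance_best assms by (simp add: pass_inv_def)
            moreover have "0 < S" by (simp add: small)
            ultimately show "run s (RStore (WLit 0) (RArr 6 (WLit 0))) (t + (wcost kV + 4)) ?Q"
              using * T False by (simp add: ok_RStore result_def)
          qed (use 4 \<open>pass_inv 0 s4\<close> in \<open>auto simp: inv_wset\<close>)
        qed
      qed
    qed (use False in auto)
  qed
  then show ?thesis
    using wfs_input_state False by (simp add: solve_prog_def ok_Cond ok_Seq eval_nat_numeral)
qed

end

theorem theorem3:
  "\<exists>(prog::com) (C::nat) (c::nat).
     \<forall>(P::point set) (w::point \<Rightarrow> real) (Q::point set) (k::nat) (n::nat) (m::nat) ps qs.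
       finite P \<and> card P = n \<and> finite Q \<and> card Q = m \<and> k \<ge> 1 \<and>
       set ps = P \<and> distinct ps \<and> set qs = Q \<and> distinct qs \<longrightarrow>
       (\<exists>t s'. exec (C * max 1 (n + m)) ((n + m + k + 1) ^ c) prog (input_state ps w qs k) t s' \<and>
          result s' = maxDominance P w Q k \<and>
          real t \<le> real C * max 1 (real k * (real m)\<^sup>2 + real n * max 1 (log 2 (real m))))"
proof (rule exI[of _ solve_prog], rule exI[of _ 5000], rule exI[of _ 14], intro allI impI, elim conjE)
  fix P Q :: "point set" and w :: "point \<Rightarrow> real" and k n m :: nat and ps qs
  assume card: "card P = n" "card Q = m" and k: "1 \<le> k"
    and lists: "set ps = P" "distinct ps" "set qs = Q" "distinct qs"
  have n: "n = length ps" and m: "m = length qs"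
    using card lists distinct_card by metis+
  define b where "b = n + m + k + 1"
  define L where "L = max 1 (log 2 (real m))"
  have b: "max 1 (n + m) \<le> b" "2 \<le> b" "m + 2 \<le> b" "k < b" using k by (auto simp: b_def)
  have pow: "b \<le> b ^ 14" "b * b \<le> b ^ 14"
    using power_increasing[of 1 14 b] power_increasing[of 2 14 b] b(2) by (simp_all add: power2_eq_square)
  \<comment> \<open>The exponent 14 comes from 2^13 = 8192 > 5000 and one more factor
    \<open>b\<close> for \<open>max 1 (n + m)\<close>.\<close>
  have "(2::nat) ^ 13 \<le> b ^ 13" by (rule power_mono) (use b in auto)
  then have "5000 * max 1 (n + m) \<le> b ^ 13 * b" using b(1) by (intro mult_le_mono) auto
  also have "\<dots> = b ^ 14" by (simp add: power_Suc2[symmetric] del: power_Suc)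
  finally have SW: "5000 * max 1 (n + m) \<le> b ^ 14" .
  have "(m + 1) * (m + 1) < b * b" using b(3) by (intro mult_strict_mono) auto
  moreover have "32 * (n + m + 2) \<le> 5000 * max 1 (n + m)" by (simp add: max_def)
  ultimately interpret ram ps w qs k "5000 * max 1 (n + m)" "b ^ 14" "length ps" "length qs"
    using SW pow b unfolding n m by unfold_locales auto
  \<comment> \<open>\<open>D\<close> is the number of binary digits of \<open>m\<close> and bounds
    the rounds of a search. For positive \<open>m\<close> it is the floor of log m plus 1, at most 2
    * L because L >= 1.\<close>
  obtain D where D: "m < 2 ^ D" "real D \<le> 2 * L"
  proof (cases "m = 0")
    case True
    then show ?thesis using that[of 0] by (simp add: L_def)
  next
    case False
    define D where "D = nat \<lfloor>log 2 (real m)\<rfloor> + 1"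
    have pos: "0 \<le> log 2 (real m)" using False by simp
    have "log 2 (real m) < real D" unfolding D_def using pos by linarith
    then have "real m < 2 powr real D" using False by (simp add: log_less_iff)
    then have "real m < real (2 ^ D)" by (simp add: powr_realpow)
    then have "m < 2 ^ D" by (simp only: of_nat_less_iff)
    moreover have "real D \<le> 2 * L" unfolding D_def L_def using pos by linarith
    ultimately show ?thesis using that by blast
  qed
  from run_solve[OF lists(2,4), of D] D(1) m obtain t s' where
    ex: "exec (5000 * max 1 (n + m)) (b ^ 14) solve_prog (input_state ps w qs k) t s'"
      "result s' = maxDominance P w Q k" and
    t: "if m = 0 then t \<le> 100
      else t \<le> m * (200 * m + 200) + n * (200 * D + 700) + 100 * m + k * (2000 * (m * m) + 20) + 1000"
    using lists unfolding ok_def n m add_0 by auto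
  have "real t \<le> 5000 * max 1 (real k * (real m)\<^sup>2 + real n * L)"
  proof (cases "m = 0")
    case True
    then show ?thesis using t by (auto simp: max_def)
  next
    case False
    have mm: "m \<le> m * m" "1 \<le> m * m" using False by auto
    have km: "m * m \<le> k * (m * m)" "k \<le> k * (m * m)" using k mm by auto
    have "t \<le> 200 * (m * m) + 300 * m + n * (200 * D + 700) + 2000 * (k * (m * m)) + 20 * k + 1000"
      using t False by (simp add: algebra_simps)
    \<comment> \<open>As k and m are positive, each of m * m, m, k and 1 is at most k * m * m, and
      2000 + 200 + 300 + 20 + 1000 = 3520.\<close>
    also have "\<dots> \<le> 4000 * (k * (m * m)) + n * (200 * D + 700)" using mm km by linarith
    finally have "real t \<le> 4000 * (real k * (real m)\<^sup>2) + real n * (200 * real D + 700)"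
      by (simp only: of_nat_le_iff[where 'a = real, symmetric]) (simp add: power2_eq_square)
    \<comment> \<open>From D <= 2 * L and 1 <= L the factor on the left is at most 1100 * L.\<close>
    also have "real n * (200 * real D + 700) \<le> real n * (5000 * L)"
      using D(2) by (intro mult_left_mono) (auto simp: L_def)
    also have "4000 * (real k * (real m)\<^sup>2) \<le> 5000 * (real k * (real m)\<^sup>2)" by simp
    finally have "real t \<le> 5000 * (real k * (real m)\<^sup>2 + real n * L)"
      by (simp add: algebra_simps)
    also have "\<dots> \<le> 5000 * max 1 (real k * (real m)\<^sup>2 + real n * L)" by (intro mult_left_mono) auto
    finally show ?thesis .
  qed
  then show "\<exists>t s'. exec (5000 * max 1 (n + m)) ((n + m + k + 1) ^ 14) solve_prog (input_state ps w qs k) t s' \<and>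
      result s' = maxDominance P w Q k \<and>
      real t \<le> real 5000 * max 1 (real k * (real m)\<^sup>2 + real n * max 1 (log 2 (real m)))"
    using ex unfolding b_def L_def by auto
qed

end
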